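(* $\mathsf{ATR}\equiv_{\mathrm{sW}}\mathsf{UC}_{\mathbb{N}^\mathbb{N}}$.
   Context: A represented space is a set $X$ with a partial surjection $\delta_X:\subseteq\mathbb{N}^\mathbb{N}\to X$ (names). A partial $F:\subseteq\mathbb{N}^\mathbb{N}\to\mathbb{N}^\mathbb{N}$ realizes a partial multivalued $f:\subseteq X\rightrightarrows Y$ if for every $x\in\operatorname{dom}(f)$ and name $p$ of $x$, $F(p)$ names an element of $f(x)$. $f\le_{\mathrm{sW}}g$ if there are computable partial $H,K$ such that $p\mapsto K(G(H(p)))$ realizes $f$ for every realizer $G$ of $g$; $\equiv_{\mathrm{sW}}$ is reducibility both ways. $\mathsf{UC}_{\mathbb{N}^\mathbb{N}}$: given a tree $T\subseteq\mathbb{N}^{<\mathbb{N}}$ (by its characteristic function) whose set of infinite paths $[T]$ is a singleton $\{x\}$, output $x$. $\mathbf{WO}$ is the represented space of well orderings $(X,\preceq_X)$ with $X\subseteq\mathbb{N}$, a name being $p$ with $p(\langle n,m\rangle)=1$ iff $n\preceq_X m$. $\mathsf{LPO}:\mathbb{N}^\mathbb{N}\to\{0,1\}$ has $\mathsf{LPO}(p)=1$ iff $p=0^\omega$. The jump $f'$ of a problem $f$ takes as input a sequence of elements of $\mathbb{N}^\mathbb{N}$ converging to a name of an input $x$ of $f$ and outputs an element of $f(x)$; $\mathsf{LPO}^{(k)}$ is the $k$-fold jump. The parallelization $\widehat{f}$ takes a sequence $(x_i)_i$ of inputs and outputs a sequence $(y_i)_i$ with $y_i\in f(x_i)$. Fix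 an effective enumeration $(\phi_n)_n$ of the computable partial functions $\subseteq\mathbb{N}^\mathbb{N}\to\mathbb{N}^\mathbb{N}$ and let $\theta^k_n=\widehat{\mathsf{LPO}^{(k)}}\circ\phi_n$, whose outputs (in $2^\mathbb{N}$) are read as subsets of $\mathbb{N}$; sets $A\subseteq\mathbb{N}$ are identified with their characteristic functions and $\oplus$ is the join. $\mathsf{ATR}:\subseteq 2^\mathbb{N}\times\mathbf{WO}\times\mathbb{N}^2\to2^\mathbb{N}$ maps $(Z,X,(k,n))$ to the set $Y$ (of codes of pairs) such that for all $(y,j)\in\mathbb{N}^2$: $\langle y,j\rangle\in Y\leftrightarrow j\in X\wedge y\in\theta^k_n(Y^j\oplus Z)$, where $Y^j=\{\langle y,i\rangle\in Y: i<_X j\}$. *)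

theory Defs
  imports "HOL-Analysis.Function_Topology" "HOL-Library.Nat_Bijection" "HOL-Library.Sublist"
begin

type_synonym baire = "nat \<Rightarrow> nat"

text \<open>Programs for unary partial recursive functions with an oracle. Arguments are packed with
  the bijection \<^const>\<open>prod_encode\<close>.\<close>

datatype prog =
    PZero | PSucc | PFst | PSnd | POracle
  | PPair prog prog
  | PComp prog prog
  | PRec prog prog
  | PMu prog

text \<open>\<open>run c p x\<close> is the output of the program \<open>c\<close> with oracle \<open>p\<close> on input \<open>x\<close>; \<^const>\<open>None\<close> means
  divergence. \<open>PRec\<close> is primitive recursion on the second component, and \<open>PMu\<close> is
  unbounded search.\<close>

primrec run :: "prog \<Rightarrow> baire \<Rightarrow> nat \<rightharpoonup> nat" where
  "run PZero p x = Some 0"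
| "run PSucc p x = Some (Suc x)"
| "run PFst p x = Some (fst (prod_decode x))"
| "run PSnd p x = Some (snd (prod_decode x))"
| "run POracle p x = Some (p x)"
| "run (PPair f g) p x =
     Option.bind (run f p x) (\<lambda>u. Option.bind (run g p x) (\<lambda>v. Some (prod_encode (u, v))))"
| "run (PComp f g) p x = Option.bind (run g p x) (run f p)"
| "run (PRec f g) p x =
     (case prod_decode x of (a, n) \<Rightarrow>
        rec_nat (run f p a)
          (\<lambda>m r. Option.bind r (\<lambda>v. run g p (prod_encode (a, prod_encode (m, v))))) n)"
| "run (PMu f) p x =
     (if \<exists>n. run f p (prod_encode (x, n)) = Some 0 \<and>
             (\<forall>m<n. run f p (prod_encode (x, m)) \<noteq> None)
      then Some (LEAST n. run f p (prod_encode (x, n)) = Some 0)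
      else None)"

text \<open>Every tag above 7 stands for \<open>PMu\<close>, so every number codes a program.\<close>

function decode_prog :: "nat \<Rightarrow> prog" where
  "decode_prog e =
     (case prod_decode e of (t, m) \<Rightarrow>
        if t = 0 then PZero
        else if t = 1 then PSucc
        else if t = 2 then PFst
        else if t = 3 then PSnd
        else if t = 4 then POracle
        else if t = 5 then
          PPair (decode_prog (fst (prod_decode m))) (decode_prog (snd (prod_decode m)))
        else if t = 6 then
          PComp (decode_prog (fst (prod_decode m))) (decode_prog (snd (prod_decode m)))
        else if t = 7 then
          PRec (decode_prog (fst (prod_decode m))) (decode_prog (snd (prod_decode m)))
        else PMu (decode_prog m))"
  by pat_completeness auto

lemma snd_decode_less:
  assumes "(t, m) = prod_decode e" and "t \<noteq> 0"
  shows "m < e"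
proof -
  have e: "e = prod_encode (t, m)"
    using assms(1) by simp
  show ?thesis
    using assms(2) by (cases t) (auto simp: e prod_encode_def)
qed

lemma decode_le: "fst (prod_decode m) \<le> m" "snd (prod_decode m) \<le> m"
  by (metis le_prod_encode_1 prod.collapse prod_decode_inverse)
     (metis le_prod_encode_2 prod.collapse prod_decode_inverse)

termination decode_prog
  by (relation "measure id")
     (auto dest!: snd_decode_less intro: le_less_trans[OF decode_le(1)] le_less_trans[OF decode_le(2)])

declare decode_prog.simps [simp del]

lemma surj_decode_prog: "\<exists>e. decode_prog e = c"
proof (induction c)
  case PZero
  show ?case by (rule exI[of _ "prod_encode (0, 0)"]) (simp add: decode_prog.simps)
next
  case PSucc
  show ?case by (rule exI[of _ "prod_encode (1, 0)"]) (simp add: decode_prog.simps)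
next
  case PFst
  show ?case by (rule exI[of _ "prod_encode (2, 0)"]) (simp add: decode_prog.simps)
next
  case PSnd
  show ?case by (rule exI[of _ "prod_encode (3, 0)"]) (simp add: decode_prog.simps)
next
  case POracle
  show ?case by (rule exI[of _ "prod_encode (4, 0)"]) (simp add: decode_prog.simps)
next
  case (PPair f g)
  then obtain a b where "decode_prog a = f" "decode_prog b = g" by blast
  then show ?case
    by (intro exI[of _ "prod_encode (5, prod_encode (a, b))"])
       (simp add: decode_prog.simps[of "prod_encode (5, prod_encode (a, b))"])
next
  case (PComp f g)
  then obtain a b where "decode_prog a = f" "decode_prog b = g" by blast
  then show ?case
    by (intro exI[of _ "prod_encode (6, prod_encode (a, b))"])
       (simp add: decode_prog.simps[of "prod_encode (6, prod_encode (a, b))"])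
next
  case (PRec f g)
  then obtain a b where "decode_prog a = f" "decode_prog b = g" by blast
  then show ?case
    by (intro exI[of _ "prod_encode (7, prod_encode (a, b))"])
       (simp add: decode_prog.simps[of "prod_encode (7, prod_encode (a, b))"])
next
  case (PMu f)
  then obtain a where "decode_prog a = f" by blast
  then show ?case
    by (intro exI[of _ "prod_encode (8, a)"])
       (simp add: decode_prog.simps[of "prod_encode (8, a)"])
qed

text \<open>The effective enumeration of the computable partial functions on Baire space: \<open>phi n p\<close> is
  defined iff program number \<open>n\<close> with oracle \<open>p\<close> halts on every input.\<close>

definition phi :: "nat \<Rightarrow> baire \<rightharpoonup> baire" where
  "phi n p = (if \<forall>x. run (decode_prog n) p x \<noteq> None
              then Some (\<lambda>x. the (run (decode_prog n) p x)) else None)"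

text \<open>As usual for functions on Baire space, nothing is required of the machine outside the
  domain of \<open>F\<close>.\<close>

definition computable :: "(baire \<rightharpoonup> baire) \<Rightarrow> bool" where
  "computable F \<longleftrightarrow> (\<exists>n. F \<subseteq>\<^sub>m phi n)"

text \<open>A represented space is given by its partial naming map; its underlying set is the range.\<close>

type_synonym 'a rep = "baire \<rightharpoonup> 'a"

text \<open>A problem is a partial multivalued function between represented spaces. Its domain consists
  of the points \<open>x\<close> of the input space with \<open>sol f x \<noteq> {}\<close>.\<close>

record ('a, 'b) problem =
  inrep :: "'a rep"
  outrep :: "'b rep"
  sol :: "'a \<Rightarrow> 'b set"

definition realizes :: "(baire \<rightharpoonup> baire) \<Rightarrow> ('a, 'b) problem \<Rightarrow> bool" where
  "realizes F f \<longleftrightarrow>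
     (\<forall>p x. inrep f p = Some x \<and> sol f x \<noteq> {} \<longrightarrow>
        (\<exists>q y. F p = Some q \<and> outrep f q = Some y \<and> y \<in> sol f x))"

definition sW_le :: "('a, 'b) problem \<Rightarrow> ('c, 'd) problem \<Rightarrow> bool" (infix \<open>\<le>\<^sub>s\<^sub>W\<close> 50) where
  "f \<le>\<^sub>s\<^sub>W g \<longleftrightarrow>
     (\<exists>H K. computable H \<and> computable K \<and>
        (\<forall>G. realizes G g \<longrightarrow> realizes (K \<circ>\<^sub>m G \<circ>\<^sub>m H) f))"

definition sW_equiv :: "('a, 'b) problem \<Rightarrow> ('c, 'd) problem \<Rightarrow> bool" (infix \<open>\<equiv>\<^sub>s\<^sub>W\<close> 50) where
  "f \<equiv>\<^sub>s\<^sub>W g \<longleftrightarrow> f \<le>\<^sub>s\<^sub>W g \<and> g \<le>\<^sub>s\<^sub>W f"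

definition row :: "baire \<Rightarrow> nat \<Rightarrow> baire" where
  "row p i = (\<lambda>n. p (prod_encode (i, n)))"

definition baire_rep :: "baire rep" where
  "baire_rep p = Some p"

definition nat_rep :: "nat rep" where
  "nat_rep p = Some (p 0)"

definition bit_rep :: "nat rep" where
  "bit_rep p = (if p 0 \<in> {0, 1} then Some (p 0) else None)"

definition chi :: "nat set \<Rightarrow> baire" where
  "chi A = (\<lambda>n. if n \<in> A then 1 else 0)"

definition set_rep :: "nat set rep" where
  "set_rep p = (if range p \<subseteq> {0, 1} then Some {n. p n = 1} else None)"

text \<open>Names of pairs are joins of names: even positions for the first component, odd
  positions for the second.\<close>

definition prod_rep :: "'a rep \<Rightarrow> 'b rep \<Rightarrow> ('a \<times> 'b) rep" (infixr \<open>\<times>\<^sub>r\<close> 70) where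
  "(\<delta> \<times>\<^sub>r \<epsilon>) p =
     (case (\<delta> (\<lambda>n. p (2 * n)), \<epsilon> (\<lambda>n. p (2 * n + 1))) of
        (Some x, Some y) \<Rightarrow> Some (x, y)
      | _ \<Rightarrow> None)"

definition seq_rep :: "'a rep \<Rightarrow> (nat \<Rightarrow> 'a) rep" where
  "seq_rep \<delta> p = (if \<forall>i. \<delta> (row p i) \<noteq> None then Some (\<lambda>i. the (\<delta> (row p i))) else None)"

text \<open>A well ordering \<open>(X, \<preceq>)\<close> is encoded as the reflexive relation \<open>\<preceq>\<close>, and \<open>X\<close> is its field.
  The empty ordering is included.\<close>

definition wo_rep :: "nat rel rep" where
  "wo_rep p = (let r = {(n, m). p (prod_encode (n, m)) = 1}
               in if Well_order r then Some r else None)"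

definition is_tree :: "nat list set \<Rightarrow> bool" where
  "is_tree T \<longleftrightarrow> (\<forall>s\<in>T. \<forall>t. prefix t s \<longrightarrow> t \<in> T)"

definition tree_rep :: "nat list set rep" where
  "tree_rep p =
     (if range p \<subseteq> {0, 1} \<and> is_tree {s. p (list_encode s) = 1}
      then Some {s. p (list_encode s) = 1} else None)"

definition paths :: "nat list set \<Rightarrow> baire set" where
  "paths T = {x. \<forall>n. map x [0..<n] \<in> T}"

definition UC_baire :: "(nat list set, baire) problem" where
  "UC_baire = \<lparr>inrep = tree_rep, outrep = baire_rep, sol = (\<lambda>T. {x. paths T = {x}})\<rparr>"

definition LPO :: "(baire, nat) problem" where
  "LPO = \<lparr>inrep = baire_rep, outrep = bit_rep,
          sol = (\<lambda>p. {if p = (\<lambda>_. 0) then 1 else 0})\<rparr>"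

text \<open>Sequences of elements of Baire space are identified with elements of Baire space
  via \<^const>\<open>row\<close>, so that jumps can be iterated. Convergence is in the product topology.\<close>

definition jump :: "('a, 'b) problem \<Rightarrow> (baire, 'b) problem" where
  "jump f = \<lparr>inrep = baire_rep, outrep = outrep f,
             sol = (\<lambda>p. {y. \<exists>q x. row p \<longlonglongrightarrow> q \<and> inrep f q = Some x \<and> y \<in> sol f x})\<rparr>"

definition parallelize :: "('a, 'b) problem \<Rightarrow> (nat \<Rightarrow> 'a, nat \<Rightarrow> 'b) problem" where
  "parallelize f = \<lparr>inrep = seq_rep (inrep f), outrep = seq_rep (outrep f),
                    sol = (\<lambda>xs. {ys. \<forall>i. ys i \<in> sol f (xs i)})\<rparr>"

lemma baire_LIMSEQ_iff:
  fixes s :: "nat \<Rightarrow> baire"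
  shows "s \<longlonglongrightarrow> q \<longleftrightarrow> (\<forall>n. \<forall>\<^sub>F i in sequentially. s i n = q n)"
proof -
  have "s \<longlonglongrightarrow> q \<longleftrightarrow> limitin (product_topology (\<lambda>_. euclidean) UNIV) s q sequentially"
    by (simp add: euclidean_product_topology limitin_canonical_iff)
  then show ?thesis
    by (simp add: limitin_componentwise limitin_canonical_iff tendsto_discrete)
qed

lemma baire_LIMSEQ_unique:
  fixes s :: "nat \<Rightarrow> baire"
  assumes "s \<longlonglongrightarrow> q" "s \<longlonglongrightarrow> q'"
  shows "q = q'"
proof
  fix n
  have "\<forall>\<^sub>F i in sequentially. s i n = q n \<and> s i n = q' n"
    using assms by (simp add: baire_LIMSEQ_iff eventually_conj)
  then show "q n = q' n"
    by (auto simp: eventually_sequentially)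
qed

text \<open>\<open>theta k n p\<close> has at most one element; it is empty iff \<open>p\<close> is outside the domain.\<close>

definition theta :: "nat \<Rightarrow> nat \<Rightarrow> baire \<Rightarrow> nat set set" where
  "theta k n p =
     {A. \<exists>q xs b. phi n p = Some q \<and>
           inrep (parallelize ((jump ^^ k) LPO)) q = Some xs \<and>
           b \<in> sol (parallelize ((jump ^^ k) LPO)) xs \<and>
           A = {y. b y = 1}}"

lemma theta_unique:
  assumes "A \<in> theta k n p" "B \<in> theta k n p"
  shows "A = B"
proof -
  have uniq: "u = v" if "u \<in> sol ((jump ^^ k) LPO) x" "v \<in> sol ((jump ^^ k) LPO) x"
    for u v x
    using that
  proof (induction k arbitrary: x)
    case 0
    then show ?case by (simp add: LPO_def)
  next
    case (Suc k)
    from Suc.prems have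
      "u \<in> sol (jump ((jump ^^ k) LPO)) x" "v \<in> sol (jump ((jump ^^ k) LPO)) x"
      by simp_all
    then obtain q q' z z' where
      "row x \<longlonglongrightarrow> q" "inrep ((jump ^^ k) LPO) q = Some z" "u \<in> sol ((jump ^^ k) LPO) z"
      "row x \<longlonglongrightarrow> q'" "inrep ((jump ^^ k) LPO) q' = Some z'" "v \<in> sol ((jump ^^ k) LPO) z'"
      unfolding jump_def[of "(jump ^^ k) LPO"] by auto
    moreover from this have "q = q'"
      using baire_LIMSEQ_unique by blast
    ultimately show ?case
      using Suc.IH by simp
  qed
  obtain q xs b b' where
    "\<forall>i. b i \<in> sol ((jump ^^ k) LPO) (xs i)" "\<forall>i. b' i \<in> sol ((jump ^^ k) LPO) (xs i)"
    "A = {y. b y = 1}" "B = {y. b' y = 1}"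
    using assms by (auto simp: theta_def parallelize_def)
  moreover from this have "b = b'"
    using uniq by blast
  ultimately show ?thesis
    by simp
qed

definition join :: "nat set \<Rightarrow> nat set \<Rightarrow> nat set" (infixl \<open>\<oplus>\<^sub>j\<close> 65) where
  "A \<oplus>\<^sub>j B = {2 * n | n. n \<in> A} \<union> {2 * n + 1 | n. n \<in> B}"

definition below :: "nat rel \<Rightarrow> nat set \<Rightarrow> nat \<Rightarrow> nat set" where
  "below r Y j = {prod_encode (y, i) | y i. prod_encode (y, i) \<in> Y \<and> (i, j) \<in> r \<and> i \<noteq> j}"

text \<open>An input is in the domain iff a solution exists for which \<open>theta\<close> is defined at
  every stage \<open>j\<close> in the field of the ordering.\<close>

definition ATR :: "(nat set \<times> nat rel \<times> nat \<times> nat, nat set) problem" where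
  "ATR = \<lparr>inrep = set_rep \<times>\<^sub>r wo_rep \<times>\<^sub>r nat_rep \<times>\<^sub>r nat_rep, outrep = set_rep,
     sol = (\<lambda>(Z, r, k, n).
       {Y. (\<forall>j\<in>Field r. theta k n (chi (below r Y j \<oplus>\<^sub>j Z)) \<noteq> {}) \<and>
           (\<forall>y j. prod_encode (y, j) \<in> Y \<longleftrightarrow>
              j \<in> Field r \<and> (\<exists>A \<in> theta k n (chi (below r Y j \<oplus>\<^sub>j Z)). y \<in> A))})\<rparr>"

end

theory Submission
  imports Defs "HOL-Library.Fun_Lexorder" "HOL-Library.Extended_Nat"
begin

text \<open>For \<open>ATR \<le>\<^sub>s\<^sub>W UC_baire\<close>, being a solution of a recursion is made a \<open>\<Pi>\<^sup>0\<^sub>1\<close> property by recording, next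
  to the solution, all the witnesses it needs: run times of the universal machine, iterated limits with
  their moduli of convergence, and the first nonzero positions found by \<open>LPO\<close>. Choosing every witness least
  makes the record unique, by induction along the well ordering, so it is the only path of a tree.

  For \<open>UC_baire \<le>\<^sub>s\<^sub>W ATR\<close>, let \<open>x\<close> be the only path of \<open>T\<close>. The tree of pairs of elements of \<open>T\<close> that
  disagree at a position announced in advance is well-founded, so that its Kleene-Brouwer order is a
  computable well ordering with the root as top element. Recursion along it prunes \<open>T\<close>: at each
  stage, those nodes are removed whose children have all been removed before. A node off the path
  is removed at the latest at the stage where it is paired with an initial segment of \<open>x\<close>; the
  initial segments themselves are never removed, and can therefore be read off at the top stage.\<close>

section \<open>Primitive recursive functionals\<close>

text \<open>Membership in the tree must be decidable from a finite segment of the path. The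
  conditions on a path are therefore given by \<open>\<mu>\<close>-free programs: these are total,
  each value depends on finitely many oracle queries, and so a false instance is refuted at a finite
  stage. The unbounded search hidden in \<open>phi\<close> has to become data: the path carries a
  whole run table indexed by fuel. The number \<open>k\<close> of jumps belongs to the input, so the
  limits are recorded under a level index. Strong reducibility lets \<open>K\<close> see only the
  answer of the realizer, never the original name. Hence the path contains the solution itself;
  conversely the solution must show which nodes of \<open>T\<close> survive, the purpose of the
  entries \<open>(1, s)\<close> made at each stage. Columns of earlier stages are kept apart, so
  that "every child has been removed at some earlier stage" is a forall-exists condition;
  \<open>LPO\<close> with one jump decides it, whence \<open>k = 1\<close>. Announcing the position
  of disagreement is what makes the tree of pairs well-founded: otherwise \<open>(x, x)\<close>
  would be an infinite branch.\<close>

primrec mu_free :: "prog \<Rightarrow> bool" where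
  "mu_free PZero = True"
| "mu_free PSucc = True"
| "mu_free PFst = True"
| "mu_free PSnd = True"
| "mu_free POracle = True"
| "mu_free (PPair f g) = (mu_free f \<and> mu_free g)"
| "mu_free (PComp f g) = (mu_free f \<and> mu_free g)"
| "mu_free (PRec f g) = (mu_free f \<and> mu_free g)"
| "mu_free (PMu f) = False"

definition pr :: "(baire \<Rightarrow> nat \<Rightarrow> nat) \<Rightarrow> bool" where
  "pr F \<longleftrightarrow> (\<exists>c. mu_free c \<and> (\<forall>p x. run c p x = Some (F p x)))"

definition pr_pred :: "(baire \<Rightarrow> nat \<Rightarrow> bool) \<Rightarrow> bool" where
  "pr_pred P \<longleftrightarrow> pr (\<lambda>p x. if P p x then 1 else 0)"

named_theorems pr_intros

lemma pr_computable:
  assumes "pr F"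
  shows "computable (\<lambda>p. Some (F p))"
proof -
  obtain c where c: "\<And>p x. run c p x = Some (F p x)"
    using assms by (auto simp: pr_def)
  obtain e where "decode_prog e = c"
    using surj_decode_prog by blast
  then have "phi e p = Some (F p)" for p
    by (simp add: phi_def c)
  then show ?thesis
    unfolding computable_def by (intro exI[of _ e]) (simp add: map_le_def)
qed

lemma pr_id [pr_intros]: "pr (\<lambda>p x. x)"
  unfolding pr_def by (rule exI[of _ "PPair PFst PSnd"]) simp

lemma pr_const [pr_intros]: "pr (\<lambda>p x. n)"
proof (induction n)
  case 0
  show ?case unfolding pr_def by (rule exI[of _ PZero]) simp
next
  case (Suc n)
  then obtain c where "mu_free c" "\<And>p x. run c p x = Some n"
    by (auto simp: pr_def)
  then show ?case
    unfolding pr_def by (intro exI[of _ "PComp PSucc c"]) simp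
qed

lemma pr_comp:
  assumes "pr F" "pr G"
  shows "pr (\<lambda>p x. F p (G p x))"
proof -
  obtain a b where "mu_free a" "\<And>p x. run a p x = Some (F p x)"
    "mu_free b" "\<And>p x. run b p x = Some (G p x)"
    using assms by (auto simp: pr_def)
  then show ?thesis
    unfolding pr_def by (intro exI[of _ "PComp a b"]) simp
qed

lemma pr_oracle [pr_intros]: "pr F \<Longrightarrow> pr (\<lambda>p x. p (F p x))"
  by (rule pr_comp[of "\<lambda>p x. p x"]) (auto simp: pr_def intro: exI[of _ POracle])

lemma pr_Suc [pr_intros]: "pr F \<Longrightarrow> pr (\<lambda>p x. Suc (F p x))"
  by (rule pr_comp[of "\<lambda>p x. Suc x"]) (auto simp: pr_def intro: exI[of _ PSucc])

lemma pr_fst [pr_intros]: "pr F \<Longrightarrow> pr (\<lambda>p x. fst (prod_decode (F p x)))"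
  by (rule pr_comp[of "\<lambda>p x. fst (prod_decode x)"]) (auto simp: pr_def intro: exI[of _ PFst])

lemma pr_snd [pr_intros]: "pr F \<Longrightarrow> pr (\<lambda>p x. snd (prod_decode (F p x)))"
  by (rule pr_comp[of "\<lambda>p x. snd (prod_decode x)"]) (auto simp: pr_def intro: exI[of _ PSnd])

lemma pr_pair [pr_intros]:
  assumes "pr F" "pr G"
  shows "pr (\<lambda>p x. prod_encode (F p x, G p x))"
proof -
  obtain a b where "mu_free a" "\<And>p x. run a p x = Some (F p x)"
    "mu_free b" "\<And>p x. run b p x = Some (G p x)"
    using assms by (auto simp: pr_def)
  then show ?thesis
    unfolding pr_def by (intro exI[of _ "PPair a b"]) simp
qed

text \<open>Bodies of binders are stated in one packed argument \<open>z\<close> in the rules below;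
  substituting a pair for \<open>z\<close> recovers the function of two arguments.\<close>

lemma pr_comp2:
  assumes "pr (\<lambda>p z. F p (fst (prod_decode z)) (snd (prod_decode z)))" "pr G" "pr H"
  shows "pr (\<lambda>p x. F p (G p x) (H p x))"
  using pr_comp[OF assms(1) pr_pair[OF assms(2,3)]] by simp

lemma pr_rec [pr_intros]:
  assumes "pr A"
    and "pr (\<lambda>p z. H p (fst (prod_decode z)) (fst (prod_decode (snd (prod_decode z))))
                (snd (prod_decode (snd (prod_decode z)))))"
    and "pr N"
  shows "pr (\<lambda>p x. rec_nat (A p x) (\<lambda>m v. H p x m v) (N p x))"
proof -
  obtain a h where a: "mu_free a" "\<And>p x. run a p x = Some (A p x)"
    and h: "mu_free h" "\<And>p z. run h p z = Some (H p (fst (prod_decode z))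
      (fst (prod_decode (snd (prod_decode z)))) (snd (prod_decode (snd (prod_decode z)))))"
    using assms(1,2) by (auto simp: pr_def)
  have "run (PRec a h) p (prod_encode (x, n)) = Some (rec_nat (A p x) (H p x) n)" for p x n
    by (induction n) (simp_all add: a h)
  then have "pr (\<lambda>p z. rec_nat (A p (fst (prod_decode z)))
      (H p (fst (prod_decode z))) (snd (prod_decode z)))"
    unfolding pr_def using a h
    by (intro exI[of _ "PRec a h"]) (metis prod.collapse prod_decode_inverse mu_free.simps(8))
  from pr_comp2[OF this pr_id assms(3)] show ?thesis .
qed

section \<open>Arithmetic, decidable predicates and bounded quantifiers\<close>

lemma pr_add [pr_intros]:
  assumes "pr F" "pr G" shows "pr (\<lambda>p x. F p x + G p x)"
proof -
  have "rec_nat m (\<lambda>_ v. Suc v) n = m + n" for m n :: nat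
    by (induction n) simp_all
  moreover have "pr (\<lambda>p x. rec_nat (F p x) (\<lambda>_ v. Suc v) (G p x))"
    by (intro pr_intros assms)
  ultimately show ?thesis by simp
qed

lemma pr_pred_nat: "pr F \<Longrightarrow> pr (\<lambda>p x. F p x - 1)"
proof -
  assume F: "pr F"
  have "rec_nat 0 (\<lambda>m _. m) n = n - 1" for n :: nat
    by (cases n) simp_all
  moreover have "pr (\<lambda>p x. rec_nat 0 (\<lambda>m _. m) (F p x))"
    by (intro pr_intros F)
  ultimately show ?thesis by simp
qed

lemma pr_diff [pr_intros]:
  assumes "pr F" "pr G" shows "pr (\<lambda>p x. F p x - G p x)"
proof -
  have "rec_nat m (\<lambda>_ v. v - 1) n = m - n" for m n :: nat
    by (induction n) simp_all
  moreover have "pr (\<lambda>p x. rec_nat (F p x) (\<lambda>_ v. v - 1) (G p x))"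
    by (intro pr_intros pr_pred_nat assms)
  ultimately show ?thesis by simp
qed

lemma pr_mult [pr_intros]:
  assumes "pr F" "pr G" shows "pr (\<lambda>p x. F p x * G p x)"
proof -
  have "rec_nat 0 (\<lambda>_ v. v + m) n = m * n" for m n :: nat
    by (induction n) simp_all
  moreover have "pr (\<lambda>p x. rec_nat 0 (\<lambda>_ v. v + F p x) (G p x))"
    by (intro pr_intros pr_comp[OF assms(1)] assms)
  ultimately show ?thesis by simp
qed

lemma pr_pred_rec_nat:
  assumes "pr F" "\<And>p x. P p x \<longleftrightarrow> F p x \<noteq> 0"
  shows "pr_pred P"
proof -
  have "1 - (1 - F p x) = (if P p x then 1 else 0)" for p x
    by (simp add: assms(2))
  moreover have "pr (\<lambda>p x. 1 - (1 - F p x))"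
    by (intro pr_intros assms)
  ultimately show ?thesis by (simp add: pr_pred_def)
qed

lemma pr_indicator: "pr_pred P \<Longrightarrow> pr (\<lambda>p x. if P p x then 1 else 0)"
  by (simp add: pr_pred_def)

lemma pr_if [pr_intros]:
  assumes "pr_pred P" "pr F" "pr G" shows "pr (\<lambda>p x. if P p x then F p x else G p x)"
proof -
  have "(\<lambda>p x. if P p x then F p x else G p x) =
      (\<lambda>p x. F p x * (if P p x then 1 else 0) + G p x * (1 - (if P p x then 1 else 0)))"
    by (intro ext) simp
  moreover have "pr \<dots>"
    by (intro pr_add pr_mult pr_diff pr_const pr_indicator assms)
  ultimately show ?thesis by simp
qed

lemma pr_le [pr_intros]: "pr F \<Longrightarrow> pr G \<Longrightarrow> pr_pred (\<lambda>p x. F p x \<le> G p x)"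
  by (rule pr_pred_rec_nat[of "\<lambda>p x. Suc (G p x) - F p x"]) (intro pr_intros, auto)

lemma pr_less [pr_intros]: "pr F \<Longrightarrow> pr G \<Longrightarrow> pr_pred (\<lambda>p x. F p x < G p x)"
  by (rule pr_pred_rec_nat[of "\<lambda>p x. G p x - F p x"]) (intro pr_intros, auto)

lemma pr_eq [pr_intros]: "pr F \<Longrightarrow> pr G \<Longrightarrow> pr_pred (\<lambda>p x. F p x = G p x)"
  by (rule pr_pred_rec_nat[of "\<lambda>p x. 1 - ((G p x - F p x) + (F p x - G p x))"]) (intro pr_intros, auto)

lemma pr_not [pr_intros]: "pr_pred P \<Longrightarrow> pr_pred (\<lambda>p x. \<not> P p x)"
  by (rule pr_pred_rec_nat[of "\<lambda>p x. 1 - (if P p x then 1 else 0)"]) (intro pr_intros pr_indicator, auto)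

lemma pr_conj [pr_intros]: "pr_pred P \<Longrightarrow> pr_pred Q \<Longrightarrow> pr_pred (\<lambda>p x. P p x \<and> Q p x)"
  by (rule pr_pred_rec_nat[of "\<lambda>p x. (if P p x then 1 else 0) * (if Q p x then 1 else 0)"])
     (intro pr_intros pr_indicator, auto)

lemma pr_disj [pr_intros]: "pr_pred P \<Longrightarrow> pr_pred Q \<Longrightarrow> pr_pred (\<lambda>p x. P p x \<or> Q p x)"
  by (rule pr_pred_rec_nat[of "\<lambda>p x. (if P p x then 1 else 0) + (if Q p x then 1 else 0)"])
     (intro pr_intros pr_indicator, auto)

lemma pr_imp [pr_intros]: "pr_pred P \<Longrightarrow> pr_pred Q \<Longrightarrow> pr_pred (\<lambda>p x. P p x \<longrightarrow> Q p x)"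
  unfolding imp_conv_disj by (intro pr_intros)

lemma pr_pred_if [pr_intros]:
  assumes "pr_pred P" "pr_pred Q" "pr_pred R"
  shows "pr_pred (\<lambda>p x. if P p x then Q p x else R p x)"
  unfolding if_bool_eq_conj by (intro pr_intros assms)

lemma pr_all_less [pr_intros]:
  assumes "pr_pred (\<lambda>p z. P p (fst (prod_decode z)) (snd (prod_decode z)))" "pr B"
  shows "pr_pred (\<lambda>p x. \<forall>i<B p x. P p x i)"
proof -
  let ?F = "\<lambda>p x. rec_nat 1 (\<lambda>i v. v * (if P p x i then 1 else 0)) (B p x)"
  have *: "rec_nat (1::nat) (\<lambda>i v. v * (if Q i then 1 else 0)) n \<noteq> 0 \<longleftrightarrow> (\<forall>i<n. Q i)" for Q n
    by (induction n) (auto simp: less_Suc_eq)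
  have P: "pr (\<lambda>p x. if P p (G p x) (H p x) then 1 else 0)" if "pr G" "pr H" for G H
    using pr_comp2[OF assms(1)[unfolded pr_pred_def] that] .
  have "pr ?F"
    by (intro pr_intros assms P)
  then show ?thesis
    by (rule pr_pred_rec_nat) (simp only: *)
qed

lemma pr_ex_less [pr_intros]:
  assumes "pr_pred (\<lambda>p z. P p (fst (prod_decode z)) (snd (prod_decode z)))" "pr B"
  shows "pr_pred (\<lambda>p x. \<exists>i<B p x. P p x i)"
proof -
  have "pr_pred (\<lambda>p x. \<not> (\<forall>i<B p x. \<not> P p x i))"
    by (intro pr_intros assms)
  then show ?thesis by simp
qed

text \<open>Bounded search: the least \<open>v \<le> n\<close> with \<open>v = n\<close> or \<open>P v\<close>.\<close>

definition search_below :: "(nat \<Rightarrow> bool) \<Rightarrow> nat \<Rightarrow> nat" where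
  "search_below P n = rec_nat 0 (\<lambda>_ v. if P v then v else Suc v) n"

lemma search_below_le: "search_below P n \<le> n"
  by (induction n) (auto simp: search_below_def)

lemma search_below_minimal: "i < search_below P n \<Longrightarrow> \<not> P i"
  by (induction n) (auto simp: search_below_def less_Suc_eq split: if_splits)

lemma search_below_sat: "search_below P n < n \<Longrightarrow> P (search_below P n)"
proof (induction n)
  case (Suc n)
  have "search_below P n \<le> n" by (rule search_below_le)
  then show ?case using Suc by (auto simp: search_below_def split: if_splits)
qed simp

lemma search_below_eqI:
  assumes "v \<le> n" "v = n \<or> P v" "\<And>i. i < v \<Longrightarrow> \<not> P i"
  shows "search_below P n = v"
  using assms search_below_le[of P n] search_below_minimal[of _ P n] search_below_sat[of P n]
  by (metis le_neq_implies_less nat_neq_iff)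

lemma pr_search_below [pr_intros]:
  assumes "pr_pred (\<lambda>p z. P p (fst (prod_decode z)) (snd (prod_decode z)))" "pr B"
  shows "pr (\<lambda>p x. search_below (\<lambda>i. P p x i) (B p x))"
proof -
  have P: "pr_pred (\<lambda>p x. P p (G p x) (H p x))" if "pr G" "pr H" for G H
    using pr_comp2[OF assms(1)[unfolded pr_pred_def] that] by (simp add: pr_pred_def)
  show ?thesis
    unfolding search_below_def by (intro pr_intros assms P)
qed

lemma pr_div2 [pr_intros]:
  assumes "pr F" shows "pr (\<lambda>p x. F p x div 2)"
proof -
  have "search_below (\<lambda>i. n < 2 * Suc i) n = n div 2" for n
    by (rule search_below_eqI) auto
  moreover have "pr (\<lambda>p x. search_below (\<lambda>i. F p x < 2 * Suc i) (F p x))"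
    by (intro pr_intros pr_comp[OF assms] assms)
  ultimately show ?thesis by simp
qed

lemma pr_even [pr_intros]:
  assumes "pr F" shows "pr_pred (\<lambda>p x. even (F p x))"
proof -
  have "pr_pred (\<lambda>p x. F p x = 2 * (F p x div 2))"
    by (intro pr_intros assms)
  moreover have "even n \<longleftrightarrow> n = 2 * (n div 2)" for n :: nat
    by presburger
  ultimately show ?thesis by presburger
qed

text \<open>A nonempty list has the successor of a pair (head, code of tail) as its code, so the
  iterated step takes tails. Truncated subtraction and \<open>prod_decode 0 = (0, 0)\<close> keep it
  at 0 once the list is exhausted.\<close>

lemma list_decode_drop:
  "list_decode (rec_nat n (\<lambda>_ v. snd (prod_decode (v - 1))) i) = drop i (list_decode n)"
proof (induction i)
  case (Suc i)
  have "list_decode (snd (prod_decode (v - 1))) = tl (list_decode v)" for v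
  proof (cases v)
    case 0
    have "prod_encode (0, 0) = 0"
      by (simp add: prod_encode_def)
    then have "prod_decode 0 = (0, 0)"
      by (metis prod_encode_inverse)
    then show ?thesis using 0 by simp
  qed (simp add: case_prod_unfold)
  then show ?case by (simp add: Suc tl_drop drop_Suc del: One_nat_def)
qed simp

lemma pr_less_length [pr_intros]:
  assumes "pr F" "pr G" shows "pr_pred (\<lambda>p x. F p x < length (list_decode (G p x)))"
proof -
  have "pr_pred (\<lambda>p x. 0 < rec_nat (G p x) (\<lambda>_ v. snd (prod_decode (v - 1))) (F p x))"
    by (intro pr_intros assms)
  moreover have "0 < rec_nat n (\<lambda>_ v. snd (prod_decode (v - 1))) i \<longleftrightarrow> i < length (list_decode n)" for n i
    using list_decode_drop[of n i]
    by (metis bot_nat_0.not_eq_extremum drop_eq_Nil linorder_not_less list_decode.simps(1) list_decode_inverse list_encode.simps(1))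
  ultimately show ?thesis by simp
qed

lemma length_list_decode_le: "length (list_decode n) \<le> n"
proof (induction n rule: less_induct)
  case (less n)
  show ?case
  proof (cases n)
    case (Suc m)
    have "snd (prod_decode m) \<le> m" by (rule decode_le)
    with less[of "snd (prod_decode m)"] Suc show ?thesis
      by (simp add: case_prod_unfold)
  qed simp
qed

lemma pr_length [pr_intros]:
  assumes "pr F" shows "pr (\<lambda>p x. length (list_decode (F p x)))"
proof -
  have "pr (\<lambda>p x. search_below (\<lambda>i. \<not> i < length (list_decode (F p x))) (F p x))"
    by (intro pr_intros pr_comp[OF assms] assms)
  moreover have "search_below (\<lambda>i. \<not> i < length (list_decode n)) n = length (list_decode n)" for n
    by (rule search_below_eqI) (auto simp: length_list_decode_le)
  ultimately show ?thesis by simp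
qed

text \<open>The value of \<open>nth\<close> beyond the end is unspecified; a fixed default makes the
  access provably primitive recursive.\<close>

definition nth_default :: "nat list \<Rightarrow> nat \<Rightarrow> nat" where
  "nth_default xs i = (if i < length xs then xs ! i else 0)"

lemma pr_nth_default [pr_intros]:
  assumes "pr F" "pr G" shows "pr (\<lambda>p x. nth_default (list_decode (F p x)) (G p x))"
proof -
  have "pr (\<lambda>p x. if G p x < length (list_decode (F p x))
     then fst (prod_decode (rec_nat (F p x) (\<lambda>_ v. snd (prod_decode (v - 1))) (G p x) - 1)) else 0)"
    by (intro pr_intros assms)
  moreover have "fst (prod_decode (rec_nat n (\<lambda>_ v. snd (prod_decode (v - 1))) i - 1)) = list_decode n ! i"
    if "i < length (list_decode n)" for n i
  proof -
    define m where "m = rec_nat n (\<lambda>_ v. snd (prod_decode (v - 1))) i"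
    have m: "list_decode m = drop i (list_decode n)"
      unfolding m_def by (rule list_decode_drop)
    then have "m \<noteq> 0"
      using that by (cases m) auto
    then obtain k where "m = Suc k"
      using not0_implies_Suc by blast
    then show ?thesis
      using m that unfolding m_def[symmetric] by (simp add: case_prod_unfold Cons_nth_drop_Suc[symmetric])
  qed
  ultimately show ?thesis by (simp add: nth_default_def cong: if_cong)
qed

section \<open>Trees of primitive recursive \<open>\<Pi>\<^sup>0\<^sub>1\<close> classes\<close>

definition pjoin :: "baire \<Rightarrow> baire \<Rightarrow> baire" where
  "pjoin f p n = (if fst (prod_decode n) = 0 then f (snd (prod_decode n)) else p (snd (prod_decode n)))"

lemma pjoin_simps [simp]:
  "pjoin f p (prod_encode (0, n)) = f n"
  "pjoin f p (prod_encode (Suc m, n)) = p n"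
  by (simp_all add: pjoin_def)

text \<open>\<open>prefix_run c s p x\<close> runs a \<open>\<mu>\<close>-free program on the oracle \<open>pjoin f p\<close>, where only the initial
  segment \<open>s\<close> of \<open>f\<close> is known: it is \<open>0\<close> if a query goes beyond \<open>s\<close>, and otherwise \<open>Suc v\<close>
  for the result \<open>v\<close>.\<close>

primrec prefix_run :: "prog \<Rightarrow> nat list \<Rightarrow> baire \<Rightarrow> nat \<Rightarrow> nat" where
  "prefix_run PZero s p x = 1"
| "prefix_run PSucc s p x = Suc (Suc x)"
| "prefix_run PFst s p x = Suc (fst (prod_decode x))"
| "prefix_run PSnd s p x = Suc (snd (prod_decode x))"
| "prefix_run POracle s p x =
     (if fst (prod_decode x) = 0
      then (if snd (prod_decode x) < length s then Suc (nth_default s (snd (prod_decode x))) else 0)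
      else Suc (p (snd (prod_decode x))))"
| "prefix_run (PPair f g) s p x =
     (if prefix_run f s p x = 0 \<or> prefix_run g s p x = 0 then 0
      else Suc (prod_encode (prefix_run f s p x - 1, prefix_run g s p x - 1)))"
| "prefix_run (PComp f g) s p x =
     (if prefix_run g s p x = 0 then 0 else prefix_run f s p (prefix_run g s p x - 1))"
| "prefix_run (PRec f g) s p x =
     rec_nat (prefix_run f s p (fst (prod_decode x)))
       (\<lambda>m r. if r = 0 then 0
              else prefix_run g s p (prod_encode (fst (prod_decode x), prod_encode (m, r - 1))))
       (snd (prod_decode x))"
| "prefix_run (PMu f) s p x = 0"

lemma pr_prefix_run [pr_intros]:
  assumes "pr F" "pr G"
  shows "pr (\<lambda>p x. prefix_run c (list_decode (F p x)) p (G p x))"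
  using assms
proof (induction c arbitrary: F G)
  case (PPair c d)
  show ?case unfolding prefix_run.simps by (intro pr_intros PPair.IH PPair.prems)
next
  case (PComp c d)
  show ?case unfolding prefix_run.simps by (intro pr_intros PComp.IH PComp.prems)
next
  case (PRec c d)
  note comp = PRec.prems[THEN pr_comp]
  show ?case unfolding prefix_run.simps by (intro pr_intros PRec.IH PRec.prems comp)
qed (unfold prefix_run.simps, (intro pr_intros; assumption)+)

text \<open>The use principle: a settled value rests on queries within \<open>s\<close> only. It
  makes refutations permanent, and hence the tree closed under prefixes.\<close>

lemma prefix_run_mono:
  assumes "prefix s t" "prefix_run c s p x \<noteq> 0"
  shows "prefix_run c t p x = prefix_run c s p x"
  using assms(2)
proof (induction c arbitrary: x)
  case POracle
  have "nth_default t i = nth_default s i" "i < length t" if "i < length s" for i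
    using assms(1) that by (auto simp: prefix_def nth_default_def nth_append)
  then show ?case using POracle by (auto split: if_splits)
next
  case (PRec c d)
  let ?a = "fst (prod_decode x)"
  let ?R = "\<lambda>s n. rec_nat (prefix_run c s p ?a) (\<lambda>m r. if r = 0 then 0
              else prefix_run d s p (prod_encode (?a, prod_encode (m, r - 1)))) n"
  have "?R s n \<noteq> 0 \<Longrightarrow> ?R t n = ?R s n" for n
    by (induction n) (auto simp: PRec.IH split: if_splits)
  then show ?case using PRec.prems by simp
qed (auto split: if_splits)

text \<open>A halting computation asks finitely many queries, all answered by long enough segments.
  Unbounded search is excluded since \<open>prefix_run\<close> never settles on it.\<close>

lemma prefix_run_converges:
  assumes "run c (pjoin f p) x = Some v" "mu_free c"
  shows "\<forall>\<^sub>F m in sequentially. prefix_run c (map f [0..<m]) p x = Suc v"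
  using assms
proof (induction c arbitrary: x v)
  case POracle
  have "\<forall>\<^sub>F m in sequentially. snd (prod_decode x) < m"
    by (rule eventually_gt_at_top)
  then show ?case
  proof (rule eventually_mono)
    fix m assume "snd (prod_decode x) < m"
    then show "prefix_run POracle (map f [0..<m]) p x = Suc v"
      using POracle by (auto simp: pjoin_def nth_default_def split: if_splits)
  qed
next
  case (PPair c d)
  then obtain a b where "run c (pjoin f p) x = Some a" "run d (pjoin f p) x = Some b"
    "v = prod_encode (a, b)"
    by (auto simp: bind_eq_Some_conv)
  with PPair.IH[of x a] PPair.IH[of x] PPair.prems
  have "\<forall>\<^sub>F m in sequentially. prefix_run c (map f [0..<m]) p x = Suc a"
    "\<forall>\<^sub>F m in sequentially. prefix_run d (map f [0..<m]) p x = Suc b"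
    by auto
  then show ?case
    by eventually_elim (simp add: \<open>v = prod_encode (a, b)\<close>)
next
  case (PComp c d)
  then obtain a where "run d (pjoin f p) x = Some a" "run c (pjoin f p) a = Some v"
    by (auto simp: bind_eq_Some_conv)
  with PComp have "\<forall>\<^sub>F m in sequentially. prefix_run d (map f [0..<m]) p x = Suc a"
    "\<forall>\<^sub>F m in sequentially. prefix_run c (map f [0..<m]) p a = Suc v"
    by auto
  then show ?case
    by eventually_elim simp
next
  case (PRec c d)
  let ?a = "fst (prod_decode x)"
  let ?R = "\<lambda>s n. rec_nat (prefix_run c s p ?a) (\<lambda>m r. if r = 0 then 0
              else prefix_run d s p (prod_encode (?a, prod_encode (m, r - 1)))) n"
  have "rec_nat (run c (pjoin f p) ?a) (\<lambda>m r. Option.bind r (\<lambda>v.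
          run d (pjoin f p) (prod_encode (?a, prod_encode (m, v))))) n = Some w
        \<Longrightarrow> \<forall>\<^sub>F m in sequentially. ?R (map f [0..<m]) n = Suc w" for n w
  proof (induction n arbitrary: w)
    case 0
    then show ?case using PRec by simp
  next
    case (Suc n)
    then obtain u where u: "rec_nat (run c (pjoin f p) ?a) (\<lambda>m r. Option.bind r (\<lambda>v.
          run d (pjoin f p) (prod_encode (?a, prod_encode (m, v))))) n = Some u"
      "run d (pjoin f p) (prod_encode (?a, prod_encode (n, u))) = Some w"
      by (auto simp: bind_eq_Some_conv)
    have "\<forall>\<^sub>F m in sequentially.
        prefix_run d (map f [0..<m]) p (prod_encode (?a, prod_encode (n, u))) = Suc w"
      using PRec.IH(2)[OF u(2)] PRec.prems by simp
    with Suc.IH[OF u(1)] show ?case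
      by eventually_elim simp
  qed
  then show ?case using PRec.prems by (simp add: case_prod_unfold)
qed simp_all

lemma prefix_map_upt:
  fixes f :: baire
  assumes "m \<le> n" shows "prefix (map f [0..<m]) (map f [0..<n])"
  using assms by (metis le_add_diff_inverse map_mono_prefix prefix_def upt_add_eq_append zero_le)

text \<open>A path is rejected as soon as an initial segment long enough to refute some instance of the
  defining condition is reached.\<close>

lemma Pi01_class_tree:
  assumes "pr_pred C"
  shows "\<exists>H. computable H \<and> (\<forall>p. \<exists>q T. H p = Some q \<and> tree_rep q = Some T \<and>
           paths T = {f. \<forall>n. C (pjoin f p) n})"
proof -
  obtain c where c: "mu_free c" "\<And>p x. run c p x = Some (if C p x then 1 else 0)"
    using assms by (auto simp: pr_pred_def pr_def)
  \<comment> \<open>The value 1 is \<open>Suc 0\<close>: the test of instance \<open>i\<close> has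
    come out false. Only instances below the length are tested, so a refuting segment must also be
    longer than the instance it refutes.\<close>
  define T where "T p = {s. \<forall>i<length s. prefix_run c s p i \<noteq> 1}" for p
  define q where "q p x = (if \<forall>i<length (list_decode x). prefix_run c (list_decode x) p i \<noteq> 1
    then 1 else 0 :: nat)" for p x
  have "pr q"
    unfolding q_def by (intro pr_intros)
  have T: "{s. q p (list_encode s) = 1} = T p" for p
    by (simp add: q_def T_def)
  have tree: "is_tree (T p)" for p
    unfolding is_tree_def
  proof (intro ballI allI impI)
    fix s t assume s: "s \<in> T p" and ts: "prefix t s"
    show "t \<in> T p"
      unfolding T_def
    proof (intro CollectI allI impI notI)
      fix i assume i: "i < length t" and eq: "prefix_run c t p i = 1"
      have "i < length s"
        using i prefix_length_le[OF ts] by simp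
      moreover have "prefix_run c s p i = 1"
        using prefix_run_mono[OF ts, of c p i] eq by simp
      ultimately show False
        using s by (auto simp: T_def)
    qed
  qed
  have "q p x \<in> {0, 1}" for p x
    by (simp add: q_def)
  then have "range (q p) \<subseteq> {0, 1}" for p
    by (meson image_subsetI)
  then have rep: "tree_rep (q p) = Some (T p)" for p
    using tree[of p] by (simp add: tree_rep_def T del: One_nat_def)
  have paths: "paths (T p) = {f. \<forall>n. C (pjoin f p) n}" for p
  proof (intro set_eqI iffI CollectI allI)
    fix f n assume f: "f \<in> paths (T p)"
    have "\<forall>\<^sub>F m in sequentially. prefix_run c (map f [0..<m]) p n = Suc (if C (pjoin f p) n then 1 else 0)"
      by (rule prefix_run_converges[OF c(2,1)])
    then have "\<forall>\<^sub>F m in sequentially. n < m \<and> prefix_run c (map f [0..<m]) p n = Suc (if C (pjoin f p) n then 1 else 0)"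
      using eventually_gt_at_top[of n] by eventually_elim simp
    then obtain m where m: "n < m" "prefix_run c (map f [0..<m]) p n = Suc (if C (pjoin f p) n then 1 else 0)"
      by (auto simp: eventually_sequentially)
    moreover have "map f [0..<m] \<in> T p"
      using f by (simp add: paths_def)
    ultimately show "C (pjoin f p) n"
      by (auto simp: T_def split: if_splits)
  next
    fix f assume f: "f \<in> {f. \<forall>n. C (pjoin f p) n}"
    have "map f [0..<m] \<in> T p" for m
      unfolding T_def
    proof (intro CollectI allI impI notI)
      fix i assume eq: "prefix_run c (map f [0..<m]) p i = 1"
      have "\<forall>\<^sub>F k in sequentially. prefix_run c (map f [0..<k]) p i = 2"
        using prefix_run_converges[OF c(2,1), of f p i] f by (simp add: numeral_2_eq_2)
      then have "\<forall>\<^sub>F k in sequentially. m \<le> k \<and> prefix_run c (map f [0..<k]) p i = 2"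
        using eventually_ge_at_top[of m] by eventually_elim simp
      then obtain k where k: "m \<le> k" "prefix_run c (map f [0..<k]) p i = 2"
        by (auto simp: eventually_sequentially)
      then show False
        using prefix_run_mono[OF prefix_map_upt[OF k(1)], of c f p i] eq by simp
    qed
    then show "f \<in> paths (T p)"
      by (simp add: paths_def)
  qed
  show ?thesis
    by (rule exI[of _ "\<lambda>p. Some (q p)"]) (auto simp: pr_computable[OF \<open>pr q\<close>] rep paths)
qed

section \<open>Iterated limits and a universal machine\<close>

abbreviation pfst :: "nat \<Rightarrow> nat" where "pfst x \<equiv> fst (prod_decode x)"
abbreviation psnd :: "nat \<Rightarrow> nat" where "psnd x \<equiv> snd (prod_decode x)"

primrec iter_lim :: "nat \<Rightarrow> baire \<Rightarrow> baire \<Rightarrow> bool" where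
  "iter_lim 0 u v \<longleftrightarrow> u = v"
| "iter_lim (Suc k) u v \<longleftrightarrow> (\<exists>w. row u \<longlonglongrightarrow> w \<and> iter_lim k w v)"

lemma inrep_jump_LPO: "inrep ((jump ^^ k) LPO) = baire_rep"
  by (cases k) (simp_all add: LPO_def jump_def)

lemma sol_jump_LPO:
  "b \<in> sol ((jump ^^ k) LPO) u \<longleftrightarrow> (\<exists>v. iter_lim k u v \<and> b = (if v = (\<lambda>_. 0) then 1 else 0))"
proof (induction k arbitrary: u)
  case (Suc k)
  have "b \<in> sol ((jump ^^ Suc k) LPO) u \<longleftrightarrow> (\<exists>w. row u \<longlonglongrightarrow> w \<and> b \<in> sol ((jump ^^ k) LPO) w)"
    by (simp add: jump_def[of "(jump ^^ k) LPO"] inrep_jump_LPO baire_rep_def)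
  then show ?case
    unfolding Suc by auto
qed (simp add: LPO_def)

text \<open>The output bits are traded for the limits \<open>v y\<close> behind them, because the
  limits are what a path can record; a bit is 1 exactly when its limit is the zero sequence.\<close>

lemma theta_iff:
  "A \<in> theta k n p \<longleftrightarrow> (\<exists>q v. phi n p = Some q \<and> (\<forall>y. iter_lim k (row q y) (v y)) \<and>
     A = {y. v y = (\<lambda>_. 0)})"
proof -
  have choice: "(\<forall>y. \<exists>v. iter_lim k (row q y) v \<and> b y = (if v = (\<lambda>_. 0) then 1 else 0)) \<longleftrightarrow>
      (\<exists>v. \<forall>y. iter_lim k (row q y) (v y) \<and> b y = (if v y = (\<lambda>_. 0) then 1 else 0))" for q and b :: baire
    by (rule choice_iff)
  have inr: "inrep (parallelize ((jump ^^ k) LPO)) q = Some (row q)" for q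
    by (simp add: parallelize_def seq_rep_def inrep_jump_LPO baire_rep_def)
  have sol: "b \<in> sol (parallelize ((jump ^^ k) LPO)) xs \<longleftrightarrow>
      (\<forall>y. \<exists>v. iter_lim k (xs y) v \<and> b y = (if v = (\<lambda>_. 0) then 1 else 0))" for xs b
    by (simp only: parallelize_def problem.simps mem_Collect_eq sol_jump_LPO)
  have "A \<in> theta k n p \<longleftrightarrow> (\<exists>q (b :: baire). phi n p = Some q \<and>
      (\<forall>y. \<exists>v. iter_lim k (row q y) v \<and> b y = (if v = (\<lambda>_. 0) then 1 else 0)) \<and> A = {y. b y = 1})"
    unfolding theta_def mem_Collect_eq inr sol option.inject by blast
  then have *: "A \<in> theta k n p \<longleftrightarrow> (\<exists>q (b :: baire) v. phi n p = Some q \<and>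
      (\<forall>y. iter_lim k (row q y) (v y) \<and> b y = (if v y = (\<lambda>_. 0) then 1 else 0)) \<and> A = {y. b y = 1})"
    unfolding choice by simp
  show ?thesis
  proof
    assume "A \<in> theta k n p"
    then obtain q v and b :: baire where "phi n p = Some q"
      "\<And>y. iter_lim k (row q y) (v y)" "\<And>y. b y = (if v y = (\<lambda>_. 0) then 1 else 0)" "A = {y. b y = 1}"
      unfolding * by blast
    then show "\<exists>q v. phi n p = Some q \<and> (\<forall>y. iter_lim k (row q y) (v y)) \<and> A = {y. v y = (\<lambda>_. 0)}"
      by (intro exI[of _ q] exI[of _ v]) auto
  next
    assume "\<exists>q v. phi n p = Some q \<and> (\<forall>y. iter_lim k (row q y) (v y)) \<and> A = {y. v y = (\<lambda>_. 0)}"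
    then obtain q v where "phi n p = Some q" "\<forall>y. iter_lim k (row q y) (v y)" "A = {y. v y = (\<lambda>_. 0)}"
      by blast
    then show "A \<in> theta k n p"
      unfolding * by (intro exI[of _ q] exI[of _ "\<lambda>y. if v y = (\<lambda>_. 0) then 1 else 0"] exI[of _ v]) auto
  qed
qed

text \<open>\<open>eval W s e x\<close> is a fuel-bounded universal machine: \<open>0\<close> if program number \<open>e\<close> yields no
  result with fuel \<open>s\<close>, and \<open>Suc v\<close> for the result \<open>v\<close>.\<close>

definition eval_step :: "(nat \<Rightarrow> nat \<Rightarrow> nat) \<Rightarrow> baire \<Rightarrow> nat \<Rightarrow> nat \<Rightarrow> nat \<Rightarrow> nat" where
  "eval_step g W s e x =
     (if pfst e = 0 then 1
      else if pfst e = 1 then Suc (Suc x)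
      else if pfst e = 2 then Suc (pfst x)
      else if pfst e = 3 then Suc (psnd x)
      else if pfst e = 4 then Suc (W x)
      else if pfst e = 5 then
        (if g (pfst (psnd e)) x = 0 \<or> g (psnd (psnd e)) x = 0 then 0
         else Suc (prod_encode (g (pfst (psnd e)) x - 1, g (psnd (psnd e)) x - 1)))
      else if pfst e = 6 then
        (if g (psnd (psnd e)) x = 0 then 0 else g (pfst (psnd e)) (g (psnd (psnd e)) x - 1))
      else if pfst e = 7 then
        (if psnd x = 0 then g (pfst (psnd e)) (pfst x)
         else if g e (prod_encode (pfst x, psnd x - 1)) = 0 then 0
         else g (psnd (psnd e)) (prod_encode (pfst x,
                prod_encode (psnd x - 1, g e (prod_encode (pfst x, psnd x - 1)) - 1))))
      else
        (if g (psnd e) (prod_encode (x, search_below (\<lambda>i. g (psnd e) (prod_encode (x, i)) \<le> 1) s)) = 1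
         then Suc (search_below (\<lambda>i. g (psnd e) (prod_encode (x, i)) \<le> 1) s) else 0))"

primrec eval :: "baire \<Rightarrow> nat \<Rightarrow> nat \<Rightarrow> nat \<Rightarrow> nat" where
  "eval W 0 = (\<lambda>_ _. 0)"
| "eval W (Suc s) = eval_step (eval W s) W s"

lemma code_cases:
  obtains m where "e = prod_encode (0, m)"
  | m where "e = prod_encode (Suc 0, m)"
  | m where "e = prod_encode (2, m)"
  | m where "e = prod_encode (3, m)"
  | m where "e = prod_encode (4, m)"
  | a b where "e = prod_encode (5, prod_encode (a, b))"
  | a b where "e = prod_encode (6, prod_encode (a, b))"
  | a b where "e = prod_encode (7, prod_encode (a, b))"
  | t m where "e = prod_encode (t, m)" "t > 7"
proof -
  obtain t m where e: "e = prod_encode (t, m)"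
    by (metis prod.collapse prod_decode_inverse)
  obtain a b where m: "m = prod_encode (a, b)"
    by (metis prod.collapse prod_decode_inverse)
  have "t = 0 \<or> t = Suc 0 \<or> t = 2 \<or> t = 3 \<or> t = 4 \<or> t = 5 \<or> t = 6 \<or> t = 7 \<or> t > 7"
    by linarith
  with that e m show thesis
    by blast
qed

lemma run_PRec:
  "run (PRec f g) p (prod_encode (a, 0)) = run f p a"
  "run (PRec f g) p (prod_encode (a, Suc n)) = Option.bind (run (PRec f g) p (prod_encode (a, n)))
     (\<lambda>v. run g p (prod_encode (a, prod_encode (n, v))))"
  by simp_all

lemma decode_prog_prod_encode:
  "decode_prog (prod_encode (0, m)) = PZero"
  "decode_prog (prod_encode (Suc 0, m)) = PSucc"
  "decode_prog (prod_encode (2, m)) = PFst"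
  "decode_prog (prod_encode (3, m)) = PSnd"
  "decode_prog (prod_encode (4, m)) = POracle"
  "decode_prog (prod_encode (5, prod_encode (a, b))) = PPair (decode_prog a) (decode_prog b)"
  "decode_prog (prod_encode (6, prod_encode (a, b))) = PComp (decode_prog a) (decode_prog b)"
  "decode_prog (prod_encode (7, prod_encode (a, b))) = PRec (decode_prog a) (decode_prog b)"
  "t > 7 \<Longrightarrow> decode_prog (prod_encode (t, m)) = PMu (decode_prog m)"
  by (simp_all add: decode_prog.simps[of "prod_encode x" for x])

lemma eval_step_prod_encode:
  "eval_step g W s (prod_encode (0, m)) x = 1"
  "eval_step g W s (prod_encode (Suc 0, m)) x = Suc (Suc x)"
  "eval_step g W s (prod_encode (2, m)) x = Suc (pfst x)"
  "eval_step g W s (prod_encode (3, m)) x = Suc (psnd x)"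
  "eval_step g W s (prod_encode (4, m)) x = Suc (W x)"
  "eval_step g W s (prod_encode (5, prod_encode (a, b))) x =
     (if g a x = 0 \<or> g b x = 0 then 0 else Suc (prod_encode (g a x - 1, g b x - 1)))"
  "eval_step g W s (prod_encode (6, prod_encode (a, b))) x = (if g b x = 0 then 0 else g a (g b x - 1))"
  "eval_step g W s (prod_encode (7, prod_encode (a, b))) (prod_encode (c, 0)) = g a c"
  "eval_step g W s (prod_encode (7, prod_encode (a, b))) (prod_encode (c, Suc n)) =
     (if g (prod_encode (7, prod_encode (a, b))) (prod_encode (c, n)) = 0 then 0
      else g b (prod_encode (c, prod_encode (n, g (prod_encode (7, prod_encode (a, b))) (prod_encode (c, n)) - 1))))"
  "t > 7 \<Longrightarrow> eval_step g W s (prod_encode (t, m)) x =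
     (if g m (prod_encode (x, search_below (\<lambda>i. g m (prod_encode (x, i)) \<le> 1) s)) = 1
      then Suc (search_below (\<lambda>i. g m (prod_encode (x, i)) \<le> 1) s) else 0)"
  by (simp_all add: eval_step_def)

lemma eval_sound:
  assumes "eval W s e x = Suc v"
  shows "run (decode_prog e) W x = Some v"
  using assms
proof (induction s arbitrary: e x v)
  case (Suc s)
  have nz: "run (decode_prog e) W x = Some (eval W s e x - 1)" if "eval W s e x \<noteq> 0" for e x
    using Suc.IH[of e x "eval W s e x - 1"] that by simp
  show ?case
  proof (cases e rule: code_cases)
    case (6 a b)
    then show ?thesis
      using Suc.prems nz[of a x] nz[of b x]
      by (auto simp: decode_prog_prod_encode eval_step_prod_encode split: if_splits)
  next
    case (7 a b)
    then show ?thesis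
      using Suc.prems nz[of b x] Suc.IH[of a "eval W s b x - 1" v]
      by (auto simp: decode_prog_prod_encode eval_step_prod_encode split: if_splits)
  next
    case (8 a b)
    obtain c n where x: "x = prod_encode (c, n)"
      by (metis prod.collapse prod_decode_inverse)
    show ?thesis
    proof (cases n)
      case 0
      then show ?thesis
        using Suc 8 by (simp add: x decode_prog_prod_encode eval_step_prod_encode)
    next
      case (Suc k)
      have nz': "eval W s e (prod_encode (c, k)) \<noteq> 0"
        and ev: "eval W s b (prod_encode (c, prod_encode (k, eval W s e (prod_encode (c, k)) - 1))) = Suc v"
        using Suc.prems 8 Suc by (auto simp: x eval_step_prod_encode split: if_splits)
      show ?thesis
        using nz[OF nz'] Suc.IH[OF ev] unfolding x Suc 8 decode_prog_prod_encode run_PRec by simp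
    qed
  next
    case (9 t m)
    \<comment> \<open>In \<open>eval\<close>, 0 means unknown and 1 means result 0. The bounded
      search stops at the first of either, and only a stop at 1 counts as a halt; every earlier
      value is then known and positive, as \<open>PMu\<close> requires.\<close>
    let ?T = "search_below (\<lambda>i. eval W s m (prod_encode (x, i)) \<le> 1) s"
    have T: "eval W s m (prod_encode (x, ?T)) = Suc 0" "v = ?T"
      using Suc.prems 9 by (auto simp: eval_step_prod_encode split: if_splits)
    have below: "\<exists>w. run (decode_prog m) W (prod_encode (x, i)) = Some (Suc w)" if "i < ?T" for i
    proof -
      have "eval W s m (prod_encode (x, i)) > 1"
        using search_below_minimal[OF that] by simp
      then show ?thesis
        using nz[of m "prod_encode (x, i)"] by (intro exI[of _ "eval W s m (prod_encode (x, i)) - 2"]) simp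
    qed
    have hit: "run (decode_prog m) W (prod_encode (x, ?T)) = Some 0"
      by (rule Suc.IH) (rule T(1))
    have "(LEAST n. run (decode_prog m) W (prod_encode (x, n)) = Some 0) = ?T"
    proof (rule Least_equality, rule hit)
      fix y assume "run (decode_prog m) W (prod_encode (x, y)) = Some 0"
      then show "?T \<le> y"
        using below[of y] by (auto simp: linorder_not_less[symmetric])
    qed
    moreover have "\<exists>n. run (decode_prog m) W (prod_encode (x, n)) = Some 0 \<and>
        (\<forall>i<n. run (decode_prog m) W (prod_encode (x, i)) \<noteq> None)"
      using hit below by (metis option.distinct(1))
    ultimately show ?thesis
      unfolding 9(1) decode_prog_prod_encode(9)[OF 9(2)] run.simps T(2) by simp
  qed (use Suc.prems in \<open>auto simp: decode_prog_prod_encode eval_step_prod_encode\<close>)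
qed simp

text \<open>"Eventually" lets the fuel of finitely many subcomputations be combined without a
  monotonicity argument. Primitive recursion calls its own code with less fuel, so it takes an inner
  induction on the recursion argument.\<close>

lemma eval_complete:
  assumes "run (decode_prog e) W x = Some v"
  shows "\<forall>\<^sub>F s in sequentially. eval W s e x = Suc v"
  using assms
proof (induction e arbitrary: x v rule: less_induct)
  case (less e)
  have le: "a \<le> prod_encode (a, b)" "b \<le> prod_encode (a, b)" for a b
    by (rule le_prod_encode_1, rule le_prod_encode_2)
  have less_code: "m < prod_encode (t, m)" if "t \<noteq> 0" for t m
    using that by (intro snd_decode_less[of t]) simp_all
  have step: "\<forall>\<^sub>F s in sequentially. eval W s e x = Suc v"
    if "\<forall>\<^sub>F s in sequentially. eval_step (eval W s) W s e x = Suc v" for x v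
    using that by (subst eventually_sequentially_Suc[symmetric]) simp
  have sub: "a < prod_encode (t, prod_encode (a, b))" "b < prod_encode (t, prod_encode (a, b))" if "t \<noteq> 0" for t a b
    using less_code[OF that, of "prod_encode (a, b)"] le(1)[of a b] le(2)[of b a] by (auto intro: le_less_trans)
  show ?case
  proof (cases e rule: code_cases)
    case (6 a b)
    obtain c d where cd: "run (decode_prog a) W x = Some c" "run (decode_prog b) W x = Some d" "v = prod_encode (c, d)"
      using less.prems 6 by (auto simp: decode_prog_prod_encode bind_eq_Some_conv)
    have "\<forall>\<^sub>F s in sequentially. eval W s a x = Suc c" "\<forall>\<^sub>F s in sequentially. eval W s b x = Suc d"
      using less.IH[OF _ cd(1)] less.IH[OF _ cd(2)] sub 6 by auto
    then show ?thesis
      by (intro step, eventually_elim) (simp add: 6 eval_step_prod_encode cd)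
  next
    case (7 a b)
    obtain d where d: "run (decode_prog b) W x = Some d" "run (decode_prog a) W d = Some v"
      using less.prems 7 by (auto simp: decode_prog_prod_encode bind_eq_Some_conv)
    have "\<forall>\<^sub>F s in sequentially. eval W s b x = Suc d" "\<forall>\<^sub>F s in sequentially. eval W s a d = Suc v"
      using less.IH[OF _ d(1)] less.IH[OF _ d(2)] sub 7 by auto
    then show ?thesis
      by (intro step, eventually_elim) (simp add: 7 eval_step_prod_encode)
  next
    case (8 a b)
    have "\<forall>\<^sub>F s in sequentially. eval W s e (prod_encode (c, n)) = Suc v"
      if "run (PRec (decode_prog a) (decode_prog b)) W (prod_encode (c, n)) = Some v" for c n v
      using that
    proof (induction n arbitrary: v)
      case 0
      then have "run (decode_prog a) W c = Some v"
        by simp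
      then have "\<forall>\<^sub>F s in sequentially. eval W s a c = Suc v"
        using less.IH sub 8 by simp
      then show ?case
        by (intro step, eventually_elim) (simp add: 8 eval_step_prod_encode)
    next
      case (Suc n)
      then obtain u where u: "run (PRec (decode_prog a) (decode_prog b)) W (prod_encode (c, n)) = Some u"
        "run (decode_prog b) W (prod_encode (c, prod_encode (n, u))) = Some v"
        unfolding run_PRec by (auto simp: bind_eq_Some_conv simp del: run.simps)
      have "\<forall>\<^sub>F s in sequentially. eval W s b (prod_encode (c, prod_encode (n, u))) = Suc v"
        using less.IH[OF _ u(2)] sub 8 by simp
      with Suc.IH[OF u(1)] show ?case
        by (intro step, eventually_elim) (simp add: 8 eval_step_prod_encode)
    qed
    then show ?thesis
      using less.prems 8 by (metis decode_prog_prod_encode(8) prod.collapse prod_decode_inverse)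
  next
    case (9 t m)
    let ?f = "\<lambda>i. run (decode_prog m) W (prod_encode (x, i))"
    have "\<exists>n. ?f n = Some 0 \<and> (\<forall>m<n. ?f m \<noteq> None)" and v: "v = (LEAST n. ?f n = Some 0)"
      using less.prems unfolding 9(1) decode_prog_prod_encode(9)[OF 9(2)] run.simps
      by (auto split: if_splits)
    then obtain n where n: "?f n = Some 0" "\<And>m. m < n \<Longrightarrow> ?f m \<noteq> None"
      by blast
    have hit: "?f v = Some 0"
      unfolding v by (rule LeastI[of _ n]) (rule n(1))
    have vn: "v \<le> n"
      unfolding v by (rule Least_le) (rule n(1))
    have "\<forall>\<^sub>F s in sequentially. eval W s m (prod_encode (x, i)) = Suc (the (?f i))" if "i \<le> v" for i
    proof (rule less.IH)
      show "m < e" using less_code[of t m] 9 by simp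
      show "?f i = Some (the (?f i))"
        using that vn n hit by (cases "i = v") auto
    qed
    then have "\<forall>\<^sub>F s in sequentially. \<forall>i\<in>{..v}. eval W s m (prod_encode (x, i)) = Suc (the (?f i))"
      by (intro eventually_ball_finite) auto
    moreover have "\<forall>\<^sub>F s in sequentially. v \<le> s"
      by (rule eventually_ge_at_top)
    ultimately show ?thesis
    proof (intro step, eventually_elim)
      case (elim s)
      have "search_below (\<lambda>i. eval W s m (prod_encode (x, i)) \<le> 1) s = v"
      proof (rule search_below_eqI)
        show "v = s \<or> eval W s m (prod_encode (x, v)) \<le> 1"
          using elim hit by simp
        fix i assume i: "i < v"
        then have "?f i \<noteq> Some 0"
          unfolding v by (rule not_less_Least)
        moreover have "?f i \<noteq> None"
          using n(2)[of i] i vn by simp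
        ultimately show "\<not> eval W s m (prod_encode (x, i)) \<le> 1"
          using elim i by auto
      qed (use elim in simp)
      then show ?case
        using elim hit by (simp add: 9(1) eval_step_prod_encode(10)[OF 9(2)])
    qed
  next
    case (1 m)
    then show ?thesis
      using less.prems by (intro step) (simp add: decode_prog_prod_encode eval_step_prod_encode)
  next
    case (2 m)
    then show ?thesis
      using less.prems by (intro step) (simp add: decode_prog_prod_encode eval_step_prod_encode)
  next
    case (3 m)
    then show ?thesis
      using less.prems by (intro step) (simp add: decode_prog_prod_encode eval_step_prod_encode)
  next
    case (4 m)
    then show ?thesis
      using less.prems by (intro step) (simp add: decode_prog_prod_encode eval_step_prod_encode)
  next
    case (5 m)
    then show ?thesis
      using less.prems by (intro step) (simp add: decode_prog_prod_encode eval_step_prod_encode)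
  qed
qed

section \<open>Reducing ATR to unique choice\<close>

text \<open>In the nested join that names an input of \<open>ATR\<close>, position \<open>n\<close>
  of the name of the ordering sits at \<open>2 * (2 * n) + 1\<close>.\<close>

definition wo_le :: "baire \<Rightarrow> nat \<Rightarrow> nat \<Rightarrow> bool" where
  "wo_le p i j \<longleftrightarrow> p (4 * prod_encode (i, j) + 1) = 1"

definition slice :: "baire \<Rightarrow> nat \<Rightarrow> nat \<Rightarrow> baire" where
  "slice f a j x = f (prod_encode (a, prod_encode (j, x)))"

text \<open>This is \<open>chi (below r Y j \<oplus>\<^sub>j Z)\<close>, with the columns of
  \<open>Y\<close> read from slice 0 of \<open>f\<close> and \<open>Z\<close> from the even
  positions of \<open>p\<close>.\<close>

definition stage_oracle :: "baire \<Rightarrow> baire \<Rightarrow> nat \<Rightarrow> baire" where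
  "stage_oracle f p j m =
     (if even m then
        (if slice f 0 (psnd (m div 2)) (pfst (m div 2)) = 1 \<and> wo_le p (psnd (m div 2)) j
            \<and> psnd (m div 2) \<noteq> j then 1 else 0)
      else p (2 * (m div 2)))"

text \<open>The slices of a path \<open>f\<close> at stage \<open>j\<close> hold: 0 the \<open>j\<close>-th column of the solution, 1 the run
  table of the universal machine on the oracle of stage \<open>j\<close>, 2 the least fuel with which program
  \<open>p 7\<close> halts, 3 the successive limits (level \<open>c\<close> of row \<open>a\<close>), 4 the least moduli of
  convergence, 5 the least nonzero position in the last limit, shifted by one so that \<open>0\<close>
  means that there is none. Minimality of the witnesses makes the path unique. The numbers
  \<open>p 3\<close> and \<open>p 7\<close> are where the name \<open>p\<close> stores \<open>k\<close> and \<open>n\<close>.\<close>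

definition path_cond :: "baire \<Rightarrow> baire \<Rightarrow> nat \<Rightarrow> nat \<Rightarrow> nat \<Rightarrow> nat \<Rightarrow> nat \<Rightarrow> bool" where
  "path_cond f p j a b c d \<longleftrightarrow>
     slice f 0 j a = (if wo_le p j j \<and> slice f 5 j a = 0 then 1 else 0) \<and>
     slice f 1 j (prod_encode (0, prod_encode (a, b))) = 0 \<and>
     slice f 1 j (prod_encode (Suc c, prod_encode (a, b))) =
       eval_step (\<lambda>e x. slice f 1 j (prod_encode (c, prod_encode (e, x)))) (stage_oracle f p j) c a b \<and>
     (wo_le p j j \<longrightarrow>
        slice f 1 j (prod_encode (slice f 2 j a, prod_encode (p 7, a))) \<noteq> 0 \<and>
        (\<forall>s<slice f 2 j a. slice f 1 j (prod_encode (s, prod_encode (p 7, a))) = 0)) \<and>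
     (\<not> wo_le p j j \<longrightarrow> slice f 2 j a = 0) \<and>
     (wo_le p j j \<longrightarrow> slice f 3 j (prod_encode (0, prod_encode (a, b))) =
        slice f 1 j (prod_encode (slice f 2 j (prod_encode (a, b)), prod_encode (p 7, prod_encode (a, b)))) - 1) \<and>
     (\<not> (wo_le p j j \<and> c \<le> p 3) \<longrightarrow> slice f 3 j (prod_encode (c, prod_encode (a, b))) = 0) \<and>
     (wo_le p j j \<and> c < p 3 \<longrightarrow>
        (slice f 4 j (prod_encode (c, prod_encode (a, b))) \<le> d \<longrightarrow>
           slice f 3 j (prod_encode (c, prod_encode (a, prod_encode (d, b)))) =
           slice f 3 j (prod_encode (Suc c, prod_encode (a, b)))) \<and>
        (slice f 4 j (prod_encode (c, prod_encode (a, b))) \<noteq> 0 \<longrightarrow>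
           slice f 3 j (prod_encode (c, prod_encode (a,
             prod_encode (slice f 4 j (prod_encode (c, prod_encode (a, b))) - 1, b)))) \<noteq>
           slice f 3 j (prod_encode (Suc c, prod_encode (a, b))))) \<and>
     (\<not> (wo_le p j j \<and> c < p 3) \<longrightarrow> slice f 4 j (prod_encode (c, prod_encode (a, b))) = 0) \<and>
     (wo_le p j j \<longrightarrow>
        (slice f 5 j a = 0 \<longrightarrow> slice f 3 j (prod_encode (p 3, prod_encode (a, b))) = 0) \<and>
        (slice f 5 j a \<noteq> 0 \<longrightarrow>
           slice f 3 j (prod_encode (p 3, prod_encode (a, slice f 5 j a - 1))) \<noteq> 0 \<and>
           (\<forall>z<slice f 5 j a - 1. slice f 3 j (prod_encode (p 3, prod_encode (a, z))) = 0))) \<and>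
     (\<not> wo_le p j j \<longrightarrow> slice f 5 j a = 0) \<and>
     (5 < c \<longrightarrow> slice f c j a = 0)"

definition path_valid :: "baire \<Rightarrow> baire \<Rightarrow> bool" where
  "path_valid p f \<longleftrightarrow> (\<forall>j a b c d. path_cond f p j a b c d)"

text \<open>Every quantifier in the condition is bounded by a recorded witness, and
  \<open>eval_step\<close> consults a single level of the table, so the closure rules
  suffice.\<close>

lemma pr_path_cond:
  "pr_pred (\<lambda>q m. path_cond (\<lambda>i. q (prod_encode (0, i))) (\<lambda>i. q (prod_encode (1, i)))
     (pfst m) (pfst (psnd m)) (pfst (psnd (psnd m)))
     (pfst (psnd (psnd (psnd m)))) (psnd (psnd (psnd (psnd m)))))"
  unfolding path_cond_def eval_step_def stage_oracle_def slice_def wo_le_def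
  by (intro pr_intros)

lemma path_valid_tree:
  "\<exists>H. computable H \<and> (\<forall>p. \<exists>q T. H p = Some q \<and> tree_rep q = Some T \<and> paths T = {f. path_valid p f})"
proof -
  have "(\<forall>m. path_cond f p (pfst m) (pfst (psnd m)) (pfst (psnd (psnd m)))
     (pfst (psnd (psnd (psnd m)))) (psnd (psnd (psnd (psnd m))))) \<longleftrightarrow> path_valid p f" for f p
  proof
    assume *: "\<forall>m. path_cond f p (pfst m) (pfst (psnd m)) (pfst (psnd (psnd m)))
     (pfst (psnd (psnd (psnd m)))) (psnd (psnd (psnd (psnd m))))"
    have "path_cond f p j a b c d" for j a b c d
      using *[rule_format, of "prod_encode (j, prod_encode (a, prod_encode (b, prod_encode (c, d))))"]
      by simp
    then show "path_valid p f"
      by (simp add: path_valid_def)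
  qed (simp add: path_valid_def)
  then show ?thesis
    using Pi01_class_tree[OF pr_path_cond] by simp
qed

section \<open>Uniqueness of the recorded path\<close>

lemma least_witness_unique:
  fixes m n :: nat
  assumes "P m" "\<And>i. i < m \<Longrightarrow> \<not> P i" "P n" "\<And>i. i < n \<Longrightarrow> \<not> P i"
  shows "m = n"
  using assms by (meson linorder_neqE_nat)

text \<open>Beyond both moduli \<open>h\<close> takes both limit values, so these agree; the larger
  modulus would then fail to be least, as seen at its predecessor.\<close>

lemma modulus_unique:
  fixes m m' :: nat
  assumes "\<And>d. m \<le> d \<Longrightarrow> h d = v" "m \<noteq> 0 \<Longrightarrow> h (m - 1) \<noteq> v"
    and "\<And>d. m' \<le> d \<Longrightarrow> h d = v'" "m' \<noteq> 0 \<Longrightarrow> h (m' - 1) \<noteq> v'"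
  shows "m = m' \<and> v = v'"
proof -
  have v: "v = v'"
    using assms(1)[of "max m m'"] assms(3)[of "max m m'"] by simp
  have "\<not> m < m'"
    using assms(1)[of "m' - 1"] assms(4) v by (cases m') auto
  moreover have "\<not> m' < m"
    using assms(3)[of "m - 1"] assms(2) v by (cases m) auto
  ultimately show ?thesis using v by simp
qed

lemma path_validD:
  assumes "path_valid p f"
  shows "slice f 0 j a = (if wo_le p j j \<and> slice f 5 j a = 0 then 1 else 0)"
    and "slice f 1 j (prod_encode (0, prod_encode (a, b))) = 0"
    and "slice f 1 j (prod_encode (Suc c, prod_encode (a, b))) =
       eval_step (\<lambda>e x. slice f 1 j (prod_encode (c, prod_encode (e, x)))) (stage_oracle f p j) c a b"
    and "wo_le p j j \<Longrightarrow>
        slice f 1 j (prod_encode (slice f 2 j a, prod_encode (p 7, a))) \<noteq> 0 \<and>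
        (\<forall>s<slice f 2 j a. slice f 1 j (prod_encode (s, prod_encode (p 7, a))) = 0)"
    and "\<not> wo_le p j j \<Longrightarrow> slice f 2 j a = 0"
    and "wo_le p j j \<Longrightarrow> slice f 3 j (prod_encode (0, prod_encode (a, b))) =
        slice f 1 j (prod_encode (slice f 2 j (prod_encode (a, b)), prod_encode (p 7, prod_encode (a, b)))) - 1"
    and "\<not> (wo_le p j j \<and> c \<le> p 3) \<Longrightarrow> slice f 3 j (prod_encode (c, prod_encode (a, b))) = 0"
    and "wo_le p j j \<Longrightarrow> c < p 3 \<Longrightarrow> slice f 4 j (prod_encode (c, prod_encode (a, b))) \<le> d \<Longrightarrow>
           slice f 3 j (prod_encode (c, prod_encode (a, prod_encode (d, b)))) =
           slice f 3 j (prod_encode (Suc c, prod_encode (a, b)))"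
    and "wo_le p j j \<Longrightarrow> c < p 3 \<Longrightarrow> slice f 4 j (prod_encode (c, prod_encode (a, b))) \<noteq> 0 \<Longrightarrow>
           slice f 3 j (prod_encode (c, prod_encode (a,
             prod_encode (slice f 4 j (prod_encode (c, prod_encode (a, b))) - 1, b)))) \<noteq>
           slice f 3 j (prod_encode (Suc c, prod_encode (a, b)))"
    and "\<not> (wo_le p j j \<and> c < p 3) \<Longrightarrow> slice f 4 j (prod_encode (c, prod_encode (a, b))) = 0"
    and "wo_le p j j \<Longrightarrow> slice f 5 j a = 0 \<Longrightarrow> slice f 3 j (prod_encode (p 3, prod_encode (a, b))) = 0"
    and "wo_le p j j \<Longrightarrow> slice f 5 j a \<noteq> 0 \<Longrightarrow>
           slice f 3 j (prod_encode (p 3, prod_encode (a, slice f 5 j a - 1))) \<noteq> 0 \<and>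
           (\<forall>z<slice f 5 j a - 1. slice f 3 j (prod_encode (p 3, prod_encode (a, z))) = 0)"
    and "\<not> wo_le p j j \<Longrightarrow> slice f 5 j a = 0"
    and "5 < c \<Longrightarrow> slice f c j a = 0"
  by (insert assms[unfolded path_valid_def, rule_format, of j a b c d, unfolded path_cond_def]) blast+

lemma path_run_table:
  assumes "path_valid p f"
  shows "slice f 1 j (prod_encode (s, prod_encode (e, x))) = eval (stage_oracle f p j) s e x"
  by (induction s arbitrary: e x) (simp_all add: path_validD(2,3)[OF assms, simplified])

lemma path_valid_unique:
  assumes f: "path_valid p f" and g: "path_valid p g"
    and wf: "wf ({(i, j). wo_le p i j} - Id)"
  shows "f = g"
proof -
  note F = path_validD[OF f] and G = path_validD[OF g]
  have "slice f a j x = slice g a j x" for a j x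
    using wf
  proof (induction j arbitrary: a x rule: wf_induct_rule)
    case (less j)
    \<comment> \<open>The oracle depends on slice 0 only at strict predecessors of \<open>j\<close>,
      where the induction hypothesis applies.\<close>
    have "stage_oracle f p j = stage_oracle g p j"
      using less by (auto simp: stage_oracle_def fun_eq_iff)
    then have s1: "slice f 1 j x = slice g 1 j x" for x
      using path_run_table[OF f, of j "pfst x" "pfst (psnd x)" "psnd (psnd x)"]
        path_run_table[OF g, of j "pfst x" "pfst (psnd x)" "psnd (psnd x)"] by simp
    have cases: "a = 0 \<or> a = 1 \<or> a = 2 \<or> a = 3 \<or> a = 4 \<or> a = 5 \<or> 5 < a"
      by linarith
    show ?case
    proof (cases "wo_le p j j")
      case False
      have "slice f 3 j x = slice g 3 j x" "slice f 4 j x = slice g 4 j x"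
        using F(7,10)[of j "pfst x" "pfst (psnd x)" "psnd (psnd x)"]
          G(7,10)[of j "pfst x" "pfst (psnd x)" "psnd (psnd x)"] False by simp_all
      moreover have "slice f 0 j x = slice g 0 j x"
        by (simp only: F(1) G(1) False simp_thms if_False)
      moreover have "slice f 2 j x = slice g 2 j x" "slice f 5 j x = slice g 5 j x"
        by (simp_all only: F(5,13)[OF False] G(5,13)[OF False])
      moreover have "slice f a j x = slice g a j x" if "5 < a"
        using that by (simp only: F(14) G(14))
      ultimately show ?thesis
        using cases s1 by blast
    next
      case True
      have s2: "slice f 2 j x = slice g 2 j x" for x
        using F(4)[OF True, of x, unfolded s1] G(4)[OF True, of x]
        by (intro least_witness_unique[of "\<lambda>s. slice g 1 j (prod_encode (s, prod_encode (p 7, x))) \<noteq> 0"]) simp_all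
      \<comment> \<open>Level \<open>c\<close> determines the modulus at \<open>c\<close> and level
        \<open>Suc c\<close> together, hence the shifted index in slice 4. The variable
        \<open>z\<close> is general because a limit at \<open>z\<close> reads the level before it at
        \<open>prod_encode (d, z)\<close>.\<close>
      have s34: "slice f 3 j (prod_encode (c, prod_encode (y, z))) = slice g 3 j (prod_encode (c, prod_encode (y, z)))
          \<and> (c \<noteq> 0 \<longrightarrow> slice f 4 j (prod_encode (c - 1, prod_encode (y, z))) = slice g 4 j (prod_encode (c - 1, prod_encode (y, z))))"
        for c y z
      proof (induction c arbitrary: z)
        case 0
        show ?case
          by (simp only: F(6)[OF True] G(6)[OF True] s1 s2) simp
      next
        case (Suc c)
        show ?case
        proof (cases "c < p 3")
          case False
          then show ?thesis
            using F(7,10)[of j _ y z] G(7,10)[of j _ y z] by simp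
        next
          case c: True
          let ?h = "\<lambda>d. slice g 3 j (prod_encode (c, prod_encode (y, prod_encode (d, z))))"
          have IH: "slice f 3 j (prod_encode (c, prod_encode (y, prod_encode (d, z)))) = ?h d" for d
            using Suc.IH by blast
          have "slice f 4 j (prod_encode (c, prod_encode (y, z))) = slice g 4 j (prod_encode (c, prod_encode (y, z)))
            \<and> slice f 3 j (prod_encode (Suc c, prod_encode (y, z))) = slice g 3 j (prod_encode (Suc c, prod_encode (y, z)))"
            by (rule modulus_unique[of _ ?h])
              (use F(8,9)[OF True c, of y z, unfolded IH] G(8,9)[OF True c, of y z] in blast)+
          then show ?thesis by simp
        qed
      qed
      have s3: "slice f 3 j x = slice g 3 j x" for x
        using s34[of "pfst x" "pfst (psnd x)" "psnd (psnd x)"] by simp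
      have s4: "slice f 4 j x = slice g 4 j x" for x
        using s34[of "Suc (pfst x)" "pfst (psnd x)" "psnd (psnd x)"] by simp
      have s5: "slice f 5 j x = slice g 5 j x" for x
      proof -
        let ?L = "\<lambda>z. slice g 3 j (prod_encode (p 3, prod_encode (x, z)))"
        note F' = F(11,12)[OF True, of x, unfolded s3] and G' = G(11,12)[OF True, of x]
        show ?thesis
        \<comment> \<open>If one record says that the limit is zero, the other cannot exhibit a
          nonzero position; otherwise both give the least such position plus one.\<close>
        proof (cases "slice f 5 j x = 0 \<or> slice g 5 j x = 0")
          case True
          then show ?thesis using F' G' by metis
        next
          case False
          then have nz: "slice f 5 j x \<noteq> 0" "slice g 5 j x \<noteq> 0"
            by simp_all
          then have "slice f 5 j x - 1 = slice g 5 j x - 1"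
            using F'(2)[OF nz(1)] G'(2)[OF nz(2)]
            by (intro least_witness_unique[of "\<lambda>z. ?L z \<noteq> 0"]) simp_all
          then show ?thesis using False by linarith
        qed
      qed
      have "slice f 0 j x = slice g 0 j x" for x
        by (simp only: F(1) G(1) s5)
      moreover have "slice f a j x = slice g a j x" if "5 < a"
        using that by (simp only: F(14) G(14))
      ultimately show ?thesis
        using cases s1 s2 s3 s4 s5 by blast
    qed
  qed
  then show ?thesis
    by (intro ext) (metis prod.collapse prod_decode_inverse slice_def)
qed

section \<open>Existence of the recorded path\<close>

lemma iter_lim_levels:
  assumes "iter_lim k u v"
  shows "\<exists>L. L 0 = u \<and> L k = v \<and> (\<forall>l<k. row (L l) \<longlonglongrightarrow> L (Suc l))"
  using assms
proof (induction k arbitrary: u)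
  case 0
  then show ?case by auto
next
  case (Suc k)
  then obtain w where w: "row u \<longlonglongrightarrow> w" "iter_lim k w v"
    by auto
  with Suc.IH obtain L where L: "L 0 = w" "L k = v" "\<forall>l<k. row (L l) \<longlonglongrightarrow> L (Suc l)"
    by blast
  show ?case
    by (rule exI[of _ "\<lambda>l. case l of 0 \<Rightarrow> u | Suc l \<Rightarrow> L l"])
      (use w L in \<open>auto simp: less_Suc_eq_0_disj split: nat.split\<close>)
qed

lemma mem_join_iff: "m \<in> A \<oplus>\<^sub>j B \<longleftrightarrow> (if even m then m div 2 \<in> A else m div 2 \<in> B)"
  by (auto simp: join_def elim!: evenE oddE) presburger+

text \<open>The nested existentials of \<open>iter_lim\<close> become one family \<open>L\<close>
  indexed by row and level, the shape stored in slice 3.\<close>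

lemma theta_levels:
  assumes "A \<in> theta k n W"
  obtains q L where "\<And>x. run (decode_prog n) W x = Some (q x)" "\<And>y. L y 0 = row q y"
    "\<And>y l. l < k \<Longrightarrow> row (L y l) \<longlonglongrightarrow> L y (Suc l)" "A = {y. L y k = (\<lambda>_. 0)}"
proof -
  obtain q v where qv: "phi n W = Some q" "\<And>y. iter_lim k (row q y) (v y)" "A = {y. v y = (\<lambda>_. 0)}"
    using assms unfolding theta_iff by blast
  have "\<forall>y. \<exists>L. L 0 = row q y \<and> L k = v y \<and> (\<forall>l<k. row (L l) \<longlonglongrightarrow> L (Suc l))"
    using iter_lim_levels[OF qv(2)] by blast
  then obtain L where "\<forall>y. L y 0 = row q y \<and> L y k = v y \<and> (\<forall>l<k. row (L y l) \<longlonglongrightarrow> L y (Suc l))"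
    by metis
  moreover have "run (decode_prog n) W x = Some (q x)" for x
    using qv(1) by (auto simp: phi_def split: if_splits)
  ultimately show thesis
    using that[of q L] qv(3) by simp
qed

lemma path_valid_exists:
  assumes bits: "\<And>m. p (2 * m) \<in> {0, 1}"
    and r: "r = {(i, j). wo_le p i j}" and field: "\<And>j. j \<in> Field r \<longleftrightarrow> wo_le p j j"
    and dom: "\<And>j. j \<in> Field r \<Longrightarrow> theta (p 3) (p 7) (chi (below r Y j \<oplus>\<^sub>j {m. p (2 * m) = 1})) \<noteq> {}"
    and Y: "\<And>y j. prod_encode (y, j) \<in> Y \<longleftrightarrow> j \<in> Field r \<and>
      (\<exists>A \<in> theta (p 3) (p 7) (chi (below r Y j \<oplus>\<^sub>j {m. p (2 * m) = 1})). y \<in> A)"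
  shows "\<exists>f. path_valid p f \<and> (\<forall>j y. slice f 0 j y = (if prod_encode (y, j) \<in> Y then 1 else 0))"
proof -
  define k n where "k = p 3" and "n = p 7"
  define W where "W j = chi (below r Y j \<oplus>\<^sub>j {m. p (2 * m) = 1})" for j
  define lims where "lims j q L \<longleftrightarrow> (\<forall>x. run (decode_prog n) (W j) x = Some (q x)) \<and>
      (\<forall>y. L y 0 = row q y) \<and> (\<forall>y l. l < k \<longrightarrow> row (L y l) \<longlonglongrightarrow> L y (Suc l)) \<and>
      (\<forall>y. prod_encode (y, j) \<in> Y \<longleftrightarrow> L y k = (\<lambda>_. 0))" for j q and L :: "nat \<Rightarrow> nat \<Rightarrow> baire"
  have "\<exists>q L. lims j q L" if j: "wo_le p j j" for j
  proof -
    obtain A where A: "A \<in> theta k n (W j)"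
      using dom[of j] j unfolding field k_def n_def W_def by blast
    \<comment> \<open>Single-valuedness of \<open>theta\<close> identifies the set in the recursion
      equation with the chosen \<open>A\<close>.\<close>
    have YA: "prod_encode (y, j) \<in> Y \<longleftrightarrow> y \<in> A" for y
      using Y[of y j] A theta_unique[OF A] j unfolding field k_def n_def W_def by blast
    show ?thesis
      using A by (rule theta_levels) (use YA in \<open>unfold lims_def, blast\<close>)
  qed
  then have "\<forall>j. \<exists>q. \<exists>L. wo_le p j j \<longrightarrow> lims j q L"
    by blast
  then obtain q where "\<forall>j. \<exists>L. wo_le p j j \<longrightarrow> lims j (q j) L"
    unfolding choice_iff by blast
  then obtain L where "\<forall>j. wo_le p j j \<longrightarrow> lims j (q j) (L j)"
    unfolding choice_iff by blast
  then have runq: "\<And>j x. wo_le p j j \<Longrightarrow> run (decode_prog n) (W j) x = Some (q j x)"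
    and L0: "\<And>j y. wo_le p j j \<Longrightarrow> L j y 0 = row (q j) y"
    and Lim: "\<And>j y l. wo_le p j j \<Longrightarrow> l < k \<Longrightarrow> row (L j y l) \<longlonglongrightarrow> L j y (Suc l)"
    and Lk: "\<And>j y. wo_le p j j \<Longrightarrow> prod_encode (y, j) \<in> Y \<longleftrightarrow> L j y k = (\<lambda>_. 0)"
    unfolding lims_def by blast+
  define S where "S j x = (LEAST s. eval (W j) s n x \<noteq> 0)" for j x
  define M where "M j c y z = (LEAST m. \<forall>d\<ge>m. L j y c (prod_encode (d, z)) = L j y (Suc c) z)" for j c y z
  define N where "N j y = (LEAST z. L j y k z \<noteq> 0)" for j y
  define F :: "nat \<Rightarrow> nat \<Rightarrow> nat \<Rightarrow> nat" where "F a j x =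
    (if a = 0 then if prod_encode (x, j) \<in> Y then 1 else 0
     else if a = 1 then eval (W j) (pfst x) (pfst (psnd x)) (psnd (psnd x))
     else if a = 2 then if wo_le p j j then S j x else 0
     else if a = 3 then if wo_le p j j \<and> pfst x \<le> k then L j (pfst (psnd x)) (pfst x) (psnd (psnd x)) else 0
     else if a = 4 then if wo_le p j j \<and> pfst x < k then M j (pfst x) (pfst (psnd x)) (psnd (psnd x)) else 0
     else if a = 5 then if wo_le p j j \<and> prod_encode (x, j) \<notin> Y then Suc (N j x) else 0
     else 0)" for a j x
  define f where "f x = F (pfst x) (pfst (psnd x)) (psnd (psnd x))" for x
  have sl: "slice f a j x = F a j x" for a j x
    by (simp add: slice_def f_def)
  have s0: "slice f 0 j x = (if prod_encode (x, j) \<in> Y then 1 else 0)" for j x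
    by (simp add: sl F_def)
  have s1: "slice f 1 j (prod_encode (s, prod_encode (e, x))) = eval (W j) s e x" for j s e x
    by (simp add: sl F_def)
  have s2: "slice f 2 j x = (if wo_le p j j then S j x else 0)" for j x
    by (simp add: sl F_def)
  have s3: "slice f 3 j (prod_encode (c, prod_encode (y, z))) = (if wo_le p j j \<and> c \<le> k then L j y c z else 0)" for j c y z
    by (simp add: sl F_def)
  have s4: "slice f 4 j (prod_encode (c, prod_encode (y, z))) = (if wo_le p j j \<and> c < k then M j c y z else 0)" for j c y z
    by (simp add: sl F_def)
  have s5: "slice f 5 j x = (if wo_le p j j \<and> prod_encode (x, j) \<notin> Y then Suc (N j x) else 0)" for j x
    by (simp add: sl F_def)
  have s6: "slice f c j x = 0" if "5 < c" for c j x
    using that by (simp add: sl F_def)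
  have YX: "wo_le p j j" if "prod_encode (y, j) \<in> Y" for y j
    using Y[of y j] that field by blast
  have stage: "stage_oracle f p j = W j" for j
  proof
    fix m
    have "psnd (m div 2) \<noteq> j \<and> wo_le p (psnd (m div 2)) j \<and> m div 2 \<in> Y \<longleftrightarrow> m div 2 \<in> below r Y j"
    proof -
      have "m div 2 \<in> below r Y j \<longleftrightarrow> prod_encode (pfst (m div 2), psnd (m div 2)) \<in> Y \<and>
          (psnd (m div 2), j) \<in> r \<and> psnd (m div 2) \<noteq> j"
        unfolding below_def by (auto simp del: prod.collapse) (metis prod.collapse prod_decode_inverse)
      then show ?thesis by (auto simp: r)
    qed
    moreover have "p (2 * (m div 2)) = (if m div 2 \<in> {m. p (2 * m) = 1} then 1 else 0)"
      using bits[of "m div 2"] by auto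
    ultimately show "stage_oracle f p j m = W j m"
      by (auto simp: stage_oracle_def W_def chi_def mem_join_iff s0)
  qed
  have S: "eval (W j) (S j x) n x = Suc (q j x)" "\<And>s. s < S j x \<Longrightarrow> eval (W j) s n x = 0"
    if "wo_le p j j" for j x
  proof -
    have "\<exists>s. eval (W j) s n x \<noteq> 0"
      using eval_complete[OF runq[OF that, of x]]
      unfolding eventually_sequentially by (metis le_refl nat.distinct(1))
    then have "eval (W j) (S j x) n x \<noteq> 0"
      unfolding S_def by (rule LeastI_ex)
    \<comment> \<open>Any nonzero table value is correct by soundness, so the least fuel already
      yields \<open>q j x\<close>.\<close>
    then obtain v where v: "eval (W j) (S j x) n x = Suc v"
      using not0_implies_Suc by blast
    with eval_sound[OF v] runq[OF that, of x] show "eval (W j) (S j x) n x = Suc (q j x)"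
      by simp
    show "eval (W j) s n x = 0" if "s < S j x" for s
      using not_less_Least[OF that[unfolded S_def]] by simp
  qed
  have M: "M j c y z \<le> d \<Longrightarrow> L j y c (prod_encode (d, z)) = L j y (Suc c) z"
    "M j c y z \<noteq> 0 \<Longrightarrow> L j y c (prod_encode (M j c y z - 1, z)) \<noteq> L j y (Suc c) z"
    if "wo_le p j j" "c < k" for j c y z d
  proof -
    let ?P = "\<lambda>m. \<forall>d\<ge>m. L j y c (prod_encode (d, z)) = L j y (Suc c) z"
    have "\<exists>m. ?P m"
      using Lim[OF that, of y] by (simp add: baire_LIMSEQ_iff eventually_sequentially row_def)
    then have *: "?P (M j c y z)"
      unfolding M_def by (rule LeastI_ex)
    then show "M j c y z \<le> d \<Longrightarrow> L j y c (prod_encode (d, z)) = L j y (Suc c) z"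
      by blast
    assume nz: "M j c y z \<noteq> 0"
    then have "M j c y z - 1 < M j c y z"
      by simp
    \<comment> \<open>A failure at or after \<open>M j c y z - 1\<close> but not at or after
      \<open>M j c y z\<close> occurs exactly at the predecessor, the one place that
      \<open>path_cond\<close> inspects.\<close>
    then have "\<not> ?P (M j c y z - 1)"
      by (rule not_less_Least[of "M j c y z - 1" ?P, folded M_def])
    then obtain d where "M j c y z - 1 \<le> d" "L j y c (prod_encode (d, z)) \<noteq> L j y (Suc c) z"
      by blast
    moreover from this have "\<not> M j c y z \<le> d"
      using * by blast
    ultimately have "d = M j c y z - 1"
      by simp
    with \<open>L j y c (prod_encode (d, z)) \<noteq> L j y (Suc c) z\<close>
    show "L j y c (prod_encode (M j c y z - 1, z)) \<noteq> L j y (Suc c) z"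
      by blast
  qed
  have N: "L j y k (N j y) \<noteq> 0" "\<And>z. z < N j y \<Longrightarrow> L j y k z = 0"
    if "wo_le p j j" "prod_encode (y, j) \<notin> Y" for j y
  proof -
    have "\<exists>z. L j y k z \<noteq> 0"
      using Lk[OF that(1), of y] that(2) by auto
    then show "L j y k (N j y) \<noteq> 0"
      unfolding N_def by (rule LeastI_ex)
    show "L j y k z = 0" if "z < N j y" for z
      using not_less_Least[OF that[unfolded N_def]] by simp
  qed
  have "path_cond f p j a b c d" for j a b c d
    unfolding path_cond_def k_def[symmetric] n_def[symmetric] stage
  proof (intro conjI)
    show "slice f 0 j a = (if wo_le p j j \<and> slice f 5 j a = 0 then 1 else 0)"
      using YX[of a j] by (simp add: s0 s5)
    show "slice f 1 j (prod_encode (0, prod_encode (a, b))) = 0"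
      by (simp only: s1 eval.simps)
    show "slice f 1 j (prod_encode (Suc c, prod_encode (a, b))) =
       eval_step (\<lambda>e x. slice f 1 j (prod_encode (c, prod_encode (e, x)))) (W j) c a b"
      by (simp only: s1 eval.simps)
    show "wo_le p j j \<longrightarrow>
        slice f 1 j (prod_encode (slice f 2 j a, prod_encode (n, a))) \<noteq> 0 \<and>
        (\<forall>s<slice f 2 j a. slice f 1 j (prod_encode (s, prod_encode (n, a))) = 0)"
      by (simp add: s1[simplified] s2 S)
    show "\<not> wo_le p j j \<longrightarrow> slice f 2 j a = 0"
      by (simp add: s2)
    show "wo_le p j j \<longrightarrow> slice f 3 j (prod_encode (0, prod_encode (a, b))) =
        slice f 1 j (prod_encode (slice f 2 j (prod_encode (a, b)), prod_encode (n, prod_encode (a, b)))) - 1"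
      by (simp add: s1[simplified] s2 s3 S L0 row_def)
    show "\<not> (wo_le p j j \<and> c \<le> k) \<longrightarrow> slice f 3 j (prod_encode (c, prod_encode (a, b))) = 0"
      by (simp add: s3)
    show "wo_le p j j \<and> c < k \<longrightarrow>
        (slice f 4 j (prod_encode (c, prod_encode (a, b))) \<le> d \<longrightarrow>
           slice f 3 j (prod_encode (c, prod_encode (a, prod_encode (d, b)))) =
           slice f 3 j (prod_encode (Suc c, prod_encode (a, b)))) \<and>
        (slice f 4 j (prod_encode (c, prod_encode (a, b))) \<noteq> 0 \<longrightarrow>
           slice f 3 j (prod_encode (c, prod_encode (a,
             prod_encode (slice f 4 j (prod_encode (c, prod_encode (a, b))) - 1, b)))) \<noteq>
           slice f 3 j (prod_encode (Suc c, prod_encode (a, b))))"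
      using M[of j c a b] by (auto simp: s3 s4)
    show "\<not> (wo_le p j j \<and> c < k) \<longrightarrow> slice f 4 j (prod_encode (c, prod_encode (a, b))) = 0"
      by (simp add: s4)
    show "wo_le p j j \<longrightarrow>
        (slice f 5 j a = 0 \<longrightarrow> slice f 3 j (prod_encode (k, prod_encode (a, b))) = 0) \<and>
        (slice f 5 j a \<noteq> 0 \<longrightarrow>
           slice f 3 j (prod_encode (k, prod_encode (a, slice f 5 j a - 1))) \<noteq> 0 \<and>
           (\<forall>z<slice f 5 j a - 1. slice f 3 j (prod_encode (k, prod_encode (a, z))) = 0))"
      using N[of j a] Lk[of j a] by (auto simp: s3 s5)
    show "\<not> wo_le p j j \<longrightarrow> slice f 5 j a = 0"
      by (simp add: s5)
    show "5 < c \<longrightarrow> slice f c j a = 0"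
      by (simp add: s6)
  qed
  then show ?thesis
    using s0 by (intro exI[of _ f]) (simp add: path_valid_def)
qed

lemma prod_rep_eq_Some_iff:
  "(\<delta> \<times>\<^sub>r \<epsilon>) p = Some (x, y) \<longleftrightarrow> \<delta> (\<lambda>n. p (2 * n)) = Some x \<and> \<epsilon> (\<lambda>n. p (2 * n + 1)) = Some y"
  by (simp add: prod_rep_def split: option.splits)

lemma ATR_name:
  assumes "inrep ATR p = Some x"
  shows "x = ({m. p (2 * m) = 1}, {(i, j). wo_le p i j}, p 3, p 7)"
    and "p (2 * m) \<in> {0, 1}" and "Well_order {(i, j). wo_le p i j}"
proof -
  let ?r = "{(i, j). wo_le p i j}"
  obtain Z r k n where x: "x = (Z, r, k, n)"
    by (metis surj_pair)
  \<comment> \<open>Positions in the nested join: each right component adds an odd step, and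
    \<open>nat_rep\<close> reads position 0 of its component, which gives 3 and 7.\<close>
  have num: "2 * (2 * n) + 1 = 4 * n + (1::nat)" "2 * (2 * (2 * 0) + 1) + 1 = (3::nat)"
    "2 * (2 * (2 * 0 + 1) + 1) + 1 = (7::nat)" for n
    by simp_all
  have "set_rep (\<lambda>n. p (2 * n)) = Some Z" "wo_rep (\<lambda>n. p (4 * n + 1)) = Some r"
    "k = p 3" "n = p 7"
    using assms unfolding ATR_def problem.simps x prod_rep_eq_Some_iff nat_rep_def num by simp_all
  then have "Well_order ?r \<and> range (\<lambda>n. p (2 * n)) \<subseteq> {0, 1} \<and> x = ({m. p (2 * m) = 1}, ?r, p 3, p 7)"
    unfolding set_rep_def wo_rep_def Let_def wo_le_def x by (simp split: if_splits)
  then show "x = ({m. p (2 * m) = 1}, {(i, j). wo_le p i j}, p 3, p 7)"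
    and "p (2 * m) \<in> {0, 1}" and "Well_order ?r"
    by auto
qed

theorem ATR_le_UC_baire: "ATR \<le>\<^sub>s\<^sub>W UC_baire"
proof -
  obtain H where H: "computable H"
    "\<And>p. \<exists>q T. H p = Some q \<and> tree_rep q = Some T \<and> paths T = {f. path_valid p f}"
    using path_valid_tree by blast
  define K :: "baire \<Rightarrow> baire" where "K f x = slice f 0 (psnd x) (pfst x)" for f x
  have "pr K"
    unfolding K_def slice_def by (intro pr_intros)
  then have K: "computable (\<lambda>f. Some (K f))"
    by (rule pr_computable)
  have "realizes ((\<lambda>f. Some (K f)) \<circ>\<^sub>m G \<circ>\<^sub>m H) ATR" if G: "realizes G UC_baire" for G
    unfolding realizes_def
  proof (intro allI impI, elim conjE)
    fix p x assume x: "inrep ATR p = Some x" and "sol ATR x \<noteq> {}"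
    then obtain Y where Y: "Y \<in> sol ATR x"
      by blast
    let ?r = "{(i, j). wo_le p i j}"
    note name = ATR_name[OF x]
    have wf: "wf (?r - Id)"
      using name(3) by (simp add: well_order_on_def)
    have refl: "refl_on (Field ?r) ?r"
      using name(3) by (simp add: order_on_defs)
    have "j \<in> Field ?r \<longleftrightarrow> wo_le p j j" for j
      using refl by (auto simp: Field_def dest: refl_onD)
    then obtain f where f: "path_valid p f"
      "\<And>j y. slice f 0 j y = (if prod_encode (y, j) \<in> Y then 1 else 0)"
      using path_valid_exists[of p ?r Y] name(2) Y unfolding name(1) ATR_def by auto
    have "{f. path_valid p f} = {f}"
      using f(1) path_valid_unique[OF _ _ wf] by blast
    then obtain q T where q: "H p = Some q" "tree_rep q = Some T" "paths T = {f}"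
      using H(2)[of p] by auto
    then have UC: "inrep UC_baire q = Some T" "sol UC_baire T = {f}"
      by (auto simp: UC_baire_def)
    have "\<exists>g y. G q = Some g \<and> outrep UC_baire g = Some y \<and> y \<in> sol UC_baire T"
      using G[unfolded realizes_def, rule_format, of q T] UC by simp
    then obtain g where "G q = Some g" "outrep UC_baire g = Some f"
      using UC by auto
    then have "G q = Some f"
      by (simp add: UC_baire_def baire_rep_def)
    moreover have "outrep ATR (K f) = Some Y"
      by (auto simp: ATR_def set_rep_def K_def f(2))
    ultimately show "\<exists>q y. ((\<lambda>f. Some (K f)) \<circ>\<^sub>m G \<circ>\<^sub>m H) p = Some q \<and> outrep ATR q = Some y \<and> y \<in> sol ATR x"
      using q(1) Y by (intro exI[of _ "K f"] exI[of _ Y]) (simp add: map_comp_def)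
  qed
  then show ?thesis
    unfolding sW_le_def using H(1) K by blast
qed

section \<open>The Kleene-Brouwer order of disagreeing pairs\<close>

text \<open>The leftmost branch through \<open>Q\<close> either ends, and is then the least element, or is an infinite
  path. The value \<open>\<infinity>\<close> marks the end of a finite sequence.\<close>

lemma wf_less_fun_enat:
  fixes D :: "(nat \<Rightarrow> enat) set"
  assumes fin: "\<And>f i j. f \<in> D \<Longrightarrow> f i = \<infinity> \<Longrightarrow> i \<le> j \<Longrightarrow> f j = \<infinity>"
    and no_path: "\<And>x. \<exists>n. \<forall>f\<in>D. \<exists>i<n. f i \<noteq> enat (x i)"
  shows "wf {(f, g). f \<in> D \<and> g \<in> D \<and> less_fun f g}"
proof (rule wfI_min)
  fix a :: "nat \<Rightarrow> enat" and Q assume aQ: "a \<in> Q"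
  show "\<exists>z\<in>Q. \<forall>y. (y, z) \<in> {(f, g). f \<in> D \<and> g \<in> D \<and> less_fun f g} \<longrightarrow> y \<notin> Q"
  proof (cases "Q \<inter> D = {}")
    case True
    then show ?thesis using aQ by blast
  next
    case False
    define S where "S = rec_nat (Q \<inter> D) (\<lambda>n A. {f \<in> A. f n = (LEAST v. \<exists>g\<in>A. g n = v)})"
    define m where "m n = (LEAST v. \<exists>g\<in>S n. g n = v)" for n
    have S0: "S 0 = Q \<inter> D" and SSuc: "S (Suc n) = {f \<in> S n. f n = m n}" for n
      by (simp_all add: S_def m_def)
    have S_iff: "S n = {f \<in> Q \<inter> D. \<forall>i<n. f i = m i}" for n
      by (induction n) (auto simp: S0 SSuc less_Suc_eq)
    have m_attained: "\<exists>f\<in>S n. f n = m n" if "S n \<noteq> {}" for n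
    proof -
      have "\<exists>v. \<exists>f\<in>S n. f n = v"
        using that by blast
      then show ?thesis
        unfolding m_def by (rule LeastI_ex)
    qed
    have nonempty: "S n \<noteq> {}" for n
    proof (induction n)
      case (Suc n)
      then show ?case using m_attained[of n] by (auto simp: SSuc)
    qed (use False S0 in simp)
    have m_le: "m n \<le> f n" if "f \<in> S n" for f n
    proof -
      have "\<exists>g\<in>S n. g n = f n"
        using that by blast
      then show ?thesis
        unfolding m_def by (rule Least_le)
    qed
    \<comment> \<open>A leftmost branch without end would be a sequence of finite values that
      members of \<open>D\<close> follow for any number of steps, against
      \<open>no_path\<close>.\<close>
    have "\<exists>n. m n = \<infinity>"
    proof (rule ccontr)
      assume "\<not> (\<exists>n. m n = \<infinity>)"
      then have m: "m n = enat (the_enat (m n))" for n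
        by (metis not_infinity_eq the_enat.simps)
      obtain n where n: "\<forall>f\<in>D. \<exists>i<n. f i \<noteq> enat (the_enat (m i))"
        using no_path[of "\<lambda>i. the_enat (m i)"] by blast
      obtain f where "f \<in> S n"
        using nonempty by blast
      then show False
        using n m unfolding S_iff by fastforce
    qed
    then obtain n where n: "m n = \<infinity>" by blast
    obtain f where "f \<in> S (Suc n)"
      using nonempty by blast
    then have f: "f \<in> Q" "f \<in> D" "\<And>i. i \<le> n \<Longrightarrow> f i = m i"
      by (auto simp: S_iff less_Suc_eq_le)
    have "g \<notin> Q" if g: "g \<in> D" "less_fun g f" for g
    proof
      assume "g \<in> Q"
      obtain k where k: "g k < f k" "\<And>i. i < k \<Longrightarrow> g i = f i"
        using g(2) by (auto elim: less_funE)
      show False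
      proof (cases "k \<le> n")
        case True
        then have "g \<in> S k"
          using \<open>g \<in> Q\<close> g(1) k(2) f(3) by (auto simp: S_iff)
        then show False
          using m_le[of g k] k(1) f(3)[OF True] by simp
      next
        case False
        then have "g n = \<infinity>"
          using k(2)[of n] f(3)[of n] n by simp
        then have "g k = \<infinity>"
          using fin[OF g(1)] False by simp
        then show False using k(1) by simp
      qed
    qed
    then show ?thesis
      using f(1) by blast
  qed
qed

text \<open>Codes of the finite sequences in the tree of disagreeing pairs: \<open>0\<close> is the empty sequence, and
  \<open>Suc (prod_encode (n, prod_encode (a, b)))\<close> is \<open>n\<close> followed by the pairs of corresponding entries
  of the lists with codes \<open>a\<close> and \<open>b\<close>, which lie in the given tree and differ at position \<open>n\<close> as
  soon as they are long enough. A tree with a single path has no infinite sequence of this kind.\<close>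

definition pair_node :: "baire \<Rightarrow> nat \<Rightarrow> bool" where
  "pair_node p m \<longleftrightarrow> m = 0 \<or>
     (p (pfst (psnd (m - 1))) = 1 \<and> p (psnd (psnd (m - 1))) = 1 \<and>
      length (list_decode (pfst (psnd (m - 1)))) = length (list_decode (psnd (psnd (m - 1)))) \<and>
      (pfst (m - 1) < length (list_decode (pfst (psnd (m - 1)))) \<longrightarrow>
        nth_default (list_decode (pfst (psnd (m - 1)))) (pfst (m - 1)) \<noteq>
        nth_default (list_decode (psnd (psnd (m - 1)))) (pfst (m - 1))))"

definition entry :: "nat \<Rightarrow> nat \<Rightarrow> nat" where
  "entry m i =
     (if m = 0 then 0
      else if i = 0 then Suc (pfst (m - 1))
      else if i - 1 < length (list_decode (pfst (psnd (m - 1)))) then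
        Suc (prod_encode (nth_default (list_decode (pfst (psnd (m - 1)))) (i - 1),
                          nth_default (list_decode (psnd (psnd (m - 1)))) (i - 1)))
      else 0)"

text \<open>The Kleene-Brouwer order. An entry \<open>0\<close> stands for the end of the sequence, which is greater
  than all entries.\<close>

definition kb_less :: "nat \<Rightarrow> nat \<Rightarrow> bool" where
  "kb_less m m' \<longleftrightarrow> (\<exists>i<Suc m. entry m i \<noteq> 0 \<and> (entry m' i = 0 \<or> entry m i < entry m' i) \<and>
     (\<forall>k<i. entry m k = entry m' k))"

definition kb_le :: "baire \<Rightarrow> nat \<Rightarrow> nat \<Rightarrow> bool" where
  "kb_le p m m' \<longleftrightarrow> pair_node p m \<and> pair_node p m' \<and> (m = m' \<or> kb_less m m')"

lemma pr_kb_le [pr_intros]: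
  assumes "pr F" "pr G"
  shows "pr_pred (\<lambda>p x. kb_le p (F p x) (G p x))"
proof -
  note comp = assms[THEN pr_comp]
  show ?thesis
    unfolding kb_le_def kb_less_def entry_def pair_node_def by (intro pr_intros assms comp)
qed

definition ext_entry :: "nat \<Rightarrow> nat \<Rightarrow> enat" where
  "ext_entry m i = (if entry m i = 0 then \<infinity> else enat (entry m i))"

lemma entry_bound: "entry m i \<noteq> 0 \<Longrightarrow> i < Suc m"
proof -
  assume e: "entry m i \<noteq> 0"
  have "length (list_decode (pfst (psnd (m - 1)))) \<le> m - 1"
    using length_list_decode_le[of "pfst (psnd (m - 1))"] decode_le[of "psnd (m - 1)"] decode_le[of "m - 1"]
    by linarith
  then show ?thesis
    using e by (auto simp: entry_def split: if_splits)
qed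

text \<open>The bound on \<open>i\<close> in \<open>kb_less\<close>, there to keep it primitive
  recursive, loses nothing by \<open>entry_bound\<close>. With the end mark 0 turned into
  \<open>\<infinity>\<close>, the order becomes the lexicographic one.\<close>

lemma kb_less_iff: "kb_less m m' \<longleftrightarrow> less_fun (ext_entry m) (ext_entry m')"
proof -
  have *: "ext_entry m i < ext_entry m' i \<longleftrightarrow> entry m i \<noteq> 0 \<and> (entry m' i = 0 \<or> entry m i < entry m' i)"
    "ext_entry m i = ext_entry m' i \<longleftrightarrow> entry m i = entry m' i" for i
    by (auto simp: ext_entry_def)
  show ?thesis
    unfolding kb_less_def less_fun_def * using entry_bound by blast
qed

lemma entry_end: "entry m i = 0 \<Longrightarrow> i \<le> j \<Longrightarrow> entry m j = 0"
  by (auto simp: entry_def split: if_splits)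

lemma node_cases:
  obtains "m = 0" | n a b where "m = Suc (prod_encode (n, prod_encode (list_encode a, list_encode b)))"
proof (cases m)
  case (Suc c)
  have "c = prod_encode (pfst c, prod_encode (list_encode (list_decode (pfst (psnd c))), list_encode (list_decode (psnd (psnd c)))))"
    by simp
  then show thesis
    using that Suc by metis
qed

lemma entry_Suc:
  "entry (Suc (prod_encode (n, prod_encode (list_encode a, list_encode b)))) 0 = Suc n"
  "entry (Suc (prod_encode (n, prod_encode (list_encode a, list_encode b)))) (Suc i) =
     (if i < length a then Suc (prod_encode (nth_default a i, nth_default b i)) else 0)"
  by (simp_all add: entry_def)

lemma pair_node_Suc:
  "pair_node p (Suc (prod_encode (n, prod_encode (list_encode a, list_encode b)))) \<longleftrightarrow>
     p (list_encode a) = 1 \<and> p (list_encode b) = 1 \<and> length a = length b \<and>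
     (n < length a \<longrightarrow> a ! n \<noteq> b ! n)"
  by (auto simp: pair_node_def nth_default_def)

text \<open>The entries are cut off at the length of the first list; the second is recovered because
  \<open>pair_node\<close> forces equal lengths.\<close>

lemma entry_inj:
  assumes "pair_node p m" "pair_node p m'" "entry m = entry m'"
  shows "m = m'"
proof (cases m rule: node_cases)
  case 1
  then show ?thesis
    using assms(3) by (auto simp: entry_def fun_eq_iff dest: spec[of _ 0] split: if_splits)
next
  case m: (2 n a b)
  show ?thesis
  proof (cases m' rule: node_cases)
    case 1
    then show ?thesis
      using assms(3) by (auto simp: entry_def fun_eq_iff dest: spec[of _ 0] split: if_splits)
  next
    case m': (2 n' a' b')
    have e: "entry m i = entry m' i" for i
      using assms(3) by simp
    have n: "n = n'"
      using e[of 0] by (simp add: m m' entry_Suc)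
    have len: "length a = length a'"
      using e[of "Suc (length a)"] e[of "Suc (length a')"]
      by (auto simp: m m' entry_Suc split: if_splits)
    have "nth_default a i = nth_default a' i \<and> nth_default b i = nth_default b' i" if "i < length a" for i
      using e[of "Suc i"] that len by (simp add: m m' entry_Suc)
    moreover have "length b = length a" "length b' = length a'"
      using assms(1,2) by (simp_all add: m m' pair_node_Suc)
    ultimately have "a = a'" "b = b'"
      using len by (auto simp: nth_default_def intro!: nth_equalityI)
    then show ?thesis
      using n m m' by simp
  qed
qed

lemma map_nth_upt:
  assumes "n \<le> length s" "\<And>i. i < n \<Longrightarrow> s ! i = x i"
  shows "map x [0..<n] = take n s"
  using assms by (intro nth_equalityI) auto

lemma Well_order_kb:
  assumes tree: "is_tree {s. p (list_encode s) = 1}"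
    and path: "paths {s. p (list_encode s) = 1} = {x}"
  shows "Well_order {(m, m'). kb_le p m m'}" and "Field {(m, m'). kb_le p m m'} = {m. pair_node p m}"
proof -
  let ?r = "{(m, m'). kb_le p m m'}"
  let ?D = "ext_entry ` {m. pair_node p m}"
  show field: "Field ?r = {m. pair_node p m}"
    by (auto simp: Field_def kb_le_def)
  have wf: "wf {(f, g). f \<in> ?D \<and> g \<in> ?D \<and> less_fun f g}"
  proof (rule wf_less_fun_enat)
    show "f j = \<infinity>" if "f \<in> ?D" "f i = \<infinity>" "i \<le> j" for f i j
      using that entry_end by (auto simp: ext_entry_def split: if_splits)
    fix y :: baire
    show "\<exists>n. \<forall>f\<in>?D. \<exists>i<n. f i \<noteq> enat (y i)"
    proof (rule ccontr)
      assume "\<not> ?thesis"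
      then have *: "\<exists>m. pair_node p m \<and> (\<forall>i<n. ext_entry m i = enat (y i))" for n
        by auto
      \<comment> \<open>An infinite branch \<open>y\<close> consists of the announced position
        \<open>y 0 - 1\<close> and two sequences. Values are shifted by one since 0 marks the end,
        places by one since entry 0 is the announcement.\<close>
      define u where "u i = pfst (y (Suc i) - 1)" for i
      define v where "v i = psnd (y (Suc i) - 1)" for i
      have nodes: "\<exists>a b. p (list_encode a) = 1 \<and> p (list_encode b) = 1 \<and> l \<le> length a \<and> length a = length b \<and>
         (\<forall>i<l. a ! i = u i \<and> b ! i = v i) \<and> (y 0 - 1 < length a \<longrightarrow> a ! (y 0 - 1) \<noteq> b ! (y 0 - 1))" for l
      proof -
        obtain m where m: "pair_node p m" "\<And>i. i < Suc l \<Longrightarrow> ext_entry m i = enat (y i)"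
          using *[of "Suc l"] by blast
        have e: "entry m i = y i \<and> y i \<noteq> 0" if "i < Suc l" for i
          using m(2)[OF that] by (auto simp: ext_entry_def split: if_splits)
        show ?thesis
        proof (cases m rule: node_cases)
          case 1
          then show ?thesis using e[of 0] by (simp add: entry_def)
        next
          case (2 n a b)
          have y0: "y 0 - 1 = n"
            using e[of 0] by (auto simp: 2 entry_Suc)
          have ent: "i < length a \<and> nth_default a i = u i \<and> nth_default b i = v i" if "i < l" for i
          proof -
            have "entry m (Suc i) = y (Suc i)" "y (Suc i) \<noteq> 0"
              using e[of "Suc i"] that by simp_all
            then have "i < length a" "y (Suc i) = Suc (prod_encode (nth_default a i, nth_default b i))"
              by (simp_all add: 2 entry_Suc split: if_splits)
            then show ?thesis
              by (simp add: u_def v_def)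
          qed
          have "l \<le> length a"
            using ent[of "length a"] by (cases "length a < l") auto
          then show ?thesis
            using m(1) ent y0 unfolding 2 pair_node_Suc
            by (intro exI[of _ a] exI[of _ b]) (auto simp: nth_default_def)
        qed
      qed
      have take_mem: "p (list_encode (take l a)) = 1" if "p (list_encode a) = 1" for a l
        using tree that take_is_prefix unfolding is_tree_def by blast
      have uv: "p (list_encode (map u [0..<l])) = 1 \<and> p (list_encode (map v [0..<l])) = 1" for l
      proof -
        obtain a b where ab: "p (list_encode a) = 1" "p (list_encode b) = 1" "l \<le> length a" "length a = length b"
          "\<And>i. i < l \<Longrightarrow> a ! i = u i" "\<And>i. i < l \<Longrightarrow> b ! i = v i"
          using nodes[of l] by blast
        have "map u [0..<l] = take l a" "map v [0..<l] = take l b"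
          using ab by (auto intro!: map_nth_upt)
        then show ?thesis
          using take_mem ab by simp
      qed
      then have "u \<in> paths {s. p (list_encode s) = 1}" "v \<in> paths {s. p (list_encode s) = 1}"
        by (simp_all add: paths_def)
      then have "u = v"
        using path by simp
      \<comment> \<open>Both sequences are paths and hence equal, but nodes that reach past the
        announced position must differ there.\<close>
      moreover obtain a b where "Suc (y 0 - 1) \<le> length a" "\<forall>i<Suc (y 0 - 1). a ! i = u i \<and> b ! i = v i"
        "y 0 - 1 < length a \<longrightarrow> a ! (y 0 - 1) \<noteq> b ! (y 0 - 1)"
        using nodes[of "Suc (y 0 - 1)"] by blast
      ultimately show False
        by simp
    qed
  qed
  have ext_inj: "m = m'" if "pair_node p m" "pair_node p m'" "ext_entry m = ext_entry m'" for m m'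
  proof (rule entry_inj[OF that(1,2)])
    show "entry m = entry m'"
    proof
      fix i show "entry m i = entry m' i"
        using fun_cong[OF that(3), of i]
        by (cases "entry m i = 0"; cases "entry m' i = 0") (simp_all add: ext_entry_def)
    qed
  qed
  have trich: "kb_less m m' \<or> m = m' \<or> kb_less m' m" if "pair_node p m" "pair_node p m'" for m m'
  proof -
    \<comment> \<open>Both sequences have ended beyond their codes, so they differ at finitely many
      places, as \<open>less_fun_trichotomy\<close> asks.\<close>
    have "finite {k. ext_entry m k \<noteq> ext_entry m' k}"
    proof (rule finite_subset)
      show "{k. ext_entry m k \<noteq> ext_entry m' k} \<subseteq> {..m + m'}"
      proof
        fix i assume "i \<in> {k. ext_entry m k \<noteq> ext_entry m' k}"
        then have "entry m i \<noteq> 0 \<or> entry m' i \<noteq> 0"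
          by (auto simp: ext_entry_def split: if_splits)
        then show "i \<in> {..m + m'}"
          using entry_bound[of m i] entry_bound[of m' i] by auto
      qed
    qed simp
    then show ?thesis
      using less_fun_trichotomy ext_inj[OF that] unfolding kb_less_iff by blast
  qed
  have "refl_on (Field ?r) ?r"
    unfolding field by (rule refl_onI) (auto simp: kb_le_def)
  moreover have "trans ?r"
    by (rule transI) (auto simp: kb_le_def kb_less_iff intro: less_fun_trans)
  moreover have "antisym ?r"
    by (rule antisymI) (auto simp: kb_le_def kb_less_iff dest: less_fun_asym)
  moreover have "total_on (Field ?r) ?r"
    unfolding field total_on_def using trich by (auto simp: kb_le_def)
  moreover have "wf (?r - Id)"
    by (rule wf_subset[OF wf_inv_image[OF wf, of ext_entry]])
      (auto simp: inv_image_def kb_le_def kb_less_iff)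
  ultimately show "Well_order ?r"
    by (auto simp: order_on_defs well_order_on_def Field_def)
qed

section \<open>Reducing unique choice to ATR\<close>

definition child :: "nat \<Rightarrow> nat \<Rightarrow> bool" where
  "child s t \<longleftrightarrow> length (list_decode t) = Suc (length (list_decode s)) \<and>
     (\<forall>i<length (list_decode s). nth_default (list_decode t) i = nth_default (list_decode s) i)"

text \<open>With oracle \<open>chi (Y \<oplus>\<^sub>j T)\<close>, where \<open>Y\<close> contains the columns before the present one, the stage
  operator below enters \<open>(0, s)\<close> if all children of \<open>s\<close> in \<open>T\<close> have been entered before, and
  \<open>(1, s)\<close> if \<open>s\<close> lies in \<open>T\<close> and has not been entered before.\<close>

definition stage_cond :: "baire \<Rightarrow> nat \<Rightarrow> nat \<Rightarrow> nat \<Rightarrow> bool" where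
  "stage_cond W y c i \<longleftrightarrow>
     (if pfst y = 0 then
        child (psnd y) c \<and> W (2 * c + 1) = 1 \<longrightarrow> W (2 * prod_encode (prod_encode (0, c), i)) = 1
      else W (2 * psnd y + 1) = 1 \<and> W (2 * prod_encode (prod_encode (0, psnd y), c)) \<noteq> 1)"

text \<open>The argument packs \<open>y\<close>, a time \<open>t\<close> and a position
  \<open>c\<close>: row \<open>t\<close> of row \<open>y\<close> is the approximation at time
  \<open>t\<close>, where position \<open>c\<close> is 0 once a witness up to \<open>t\<close> has
  appeared.\<close>

definition stage_fun :: "baire \<Rightarrow> nat \<Rightarrow> nat" where
  "stage_fun W w =
     (if \<exists>i<Suc (pfst (psnd w)). stage_cond W (pfst w) (psnd (psnd w)) i then 0 else 1)"

lemma pr_stage_fun: "pr stage_fun"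
proof -
  have "pr (\<lambda>W w. stage_fun W w)"
    unfolding stage_fun_def stage_cond_def child_def
    by (intro pr_intros)
  then show ?thesis by simp
qed

text \<open>Each position of the approximation changes at most once, from 1 to 0, so the limit
  exists for every oracle. \<open>LPO\<close> of the limit then supplies the universal quantifier
  over \<open>c\<close>.\<close>

lemma theta_Suc_0:
  assumes "\<And>W. phi e W = Some (stage_fun W)"
  shows "theta (Suc 0) e W = {{y. \<forall>c. \<exists>i. stage_cond W y c i}}"
proof -
  define v :: "nat \<Rightarrow> baire" where "v y c = (if \<exists>i. stage_cond W y c i then 0 else 1)" for y c
  have lim: "row (row (stage_fun W) y) \<longlonglongrightarrow> v y" for y
    unfolding baire_LIMSEQ_iff
  proof
    fix c
    have row: "row (row (stage_fun W) y) t c = (if \<exists>i<Suc t. stage_cond W y c i then 0 else 1)" for t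
      by (simp add: row_def stage_fun_def)
    show "\<forall>\<^sub>F t in sequentially. row (row (stage_fun W) y) t c = v y c"
    proof (cases "\<exists>i. stage_cond W y c i")
      case True
      then obtain i where "stage_cond W y c i" by blast
      then have "row (row (stage_fun W) y) t c = v y c" if "i \<le> t" for t
        using that unfolding row v_def by (metis less_Suc_eq_le)
      then show ?thesis
        unfolding eventually_sequentially by blast
    next
      case False
      then show ?thesis
        by (simp add: row v_def)
    qed
  qed
  have "A \<in> theta (Suc 0) e W \<longleftrightarrow> A = {y. v y = (\<lambda>_. 0)}" for A
  proof -
    have "iter_lim (Suc 0) (row (stage_fun W) y) u \<longleftrightarrow> u = v y" for y u
      using lim[of y] baire_LIMSEQ_unique by auto
    then have "A \<in> theta (Suc 0) e W \<longleftrightarrow> (\<exists>u. (\<forall>y. u y = v y) \<and> A = {y. u y = (\<lambda>_. 0)})"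
      by (simp only: theta_iff assms option.inject) blast
    also have "\<dots> \<longleftrightarrow> A = {y. v y = (\<lambda>_. 0)}"
    proof
      assume "\<exists>u. (\<forall>y. u y = v y) \<and> A = {y. u y = (\<lambda>_. 0)}"
      then obtain u where "\<And>y. u y = v y" "A = {y. u y = (\<lambda>_. 0)}"
        by blast
      then show "A = {y. v y = (\<lambda>_. 0)}"
        by simp
    next
      assume "A = {y. v y = (\<lambda>_. 0)}"
      then show "\<exists>u. (\<forall>y. u y = v y) \<and> A = {y. u y = (\<lambda>_. 0)}"
        by (intro exI[of _ v]) simp
    qed
    finally show ?thesis .
  qed
  moreover have "v y = (\<lambda>_. 0) \<longleftrightarrow> (\<forall>c. \<exists>i. stage_cond W y c i)" for y
    by (auto simp: v_def fun_eq_iff split: if_splits)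
  ultimately show ?thesis
    by auto
qed

text \<open>Well-founded recursion, as a column depends only on those at strict predecessors. It
  puts the constructed instance into the domain of \<open>ATR\<close>, without which a realizer
  promises nothing.\<close>

lemma transfinite_columns:
  fixes r :: "nat rel" and Op :: "nat set \<Rightarrow> nat set"
  assumes "wf (r - Id)"
  shows "\<exists>Y. \<forall>y j. prod_encode (y, j) \<in> Y \<longleftrightarrow> j \<in> Field r \<and> y \<in> Op (below r Y j)"
proof -
  define F where "F C j = Op {prod_encode (y, i) | y i. i \<in> Field r \<and> (i, j) \<in> r \<and> i \<noteq> j \<and> y \<in> C i}"
    for C :: "nat \<Rightarrow> nat set" and j
  define C where "C = wfrec (r - Id) F"
  have C: "C j = F C j" for j
  proof -
    have "C j = F (cut C (r - Id) j) j"
      unfolding C_def by (rule wfrec[OF assms])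
    moreover have "cut C (r - Id) j i = C i" if "(i, j) \<in> r" "i \<noteq> j" for i
      using that by (simp add: cut_def)
    then have "F (cut C (r - Id) j) j = F C j"
      unfolding F_def by (intro arg_cong[of _ _ Op] Collect_cong) (simp cong: conj_cong)
    ultimately show ?thesis by simp
  qed
  define Y where "Y = {prod_encode (y, j) | y j. j \<in> Field r \<and> y \<in> C j}"
  have Y: "prod_encode (y, j) \<in> Y \<longleftrightarrow> j \<in> Field r \<and> y \<in> C j" for y j
    by (auto simp: Y_def)
  have "below r Y j = {prod_encode (y, i) | y i. i \<in> Field r \<and> (i, j) \<in> r \<and> i \<noteq> j \<and> y \<in> C i}" for j
    unfolding below_def Y by blast
  then have "C j = Op (below r Y j)" for j
    using C[of j] by (simp only: F_def)
  then show ?thesis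
    using Y by metis
qed

lemma chi_join:
  "chi (A \<oplus>\<^sub>j B) (2 * m) = 1 \<longleftrightarrow> m \<in> A"
  "chi (A \<oplus>\<^sub>j B) (2 * m + 1) = 1 \<longleftrightarrow> m \<in> B"
  by (auto simp: chi_def mem_join_iff)

lemma prod_encode_mem_below:
  "prod_encode (y, i) \<in> below r Y j \<longleftrightarrow> prod_encode (y, i) \<in> Y \<and> (i, j) \<in> r \<and> i \<noteq> j"
  by (auto simp: below_def)

text \<open>For tag 0 the universal variable runs over children and the existential one over earlier
  stages; for tag 1 the universal variable runs over earlier stages.\<close>

lemma stage_op_iff:
  "(\<forall>c. \<exists>i. stage_cond (chi (below r Y j \<oplus>\<^sub>j Z)) (prod_encode (0, s)) c i) \<longleftrightarrow>
     (\<forall>t. child s t \<and> t \<in> Z \<longrightarrow> (\<exists>i. prod_encode (prod_encode (0, t), i) \<in> Y \<and> (i, j) \<in> r \<and> i \<noteq> j))"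
  "(\<forall>c. \<exists>i. stage_cond (chi (below r Y j \<oplus>\<^sub>j Z)) (prod_encode (1, s)) c i) \<longleftrightarrow>
     s \<in> Z \<and> (\<forall>i. prod_encode (prod_encode (0, s), i) \<in> Y \<longrightarrow> \<not> ((i, j) \<in> r \<and> i \<noteq> j))"
  unfolding stage_cond_def chi_join prod_encode_mem_below by auto

text \<open>Off the path \<open>x\<close>, the column of the pair consisting of \<open>s\<close> and of the initial segment of \<open>x\<close>
  of the same length contains \<open>s\<close>; on the path, no column does.\<close>

lemma columns_detect_path:
  assumes tree: "is_tree {s. p (list_encode s) = 1}"
    and path: "paths {s. p (list_encode s) = 1} = {x}"
    and r: "r = {(m, m'). kb_le p m m'}"
    and zero: "\<And>s j. prod_encode (prod_encode (0, s), j) \<in> Y \<longleftrightarrow> j \<in> Field r \<and>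
      (\<forall>t. child s t \<and> p t = 1 \<longrightarrow> (\<exists>i. prod_encode (prod_encode (0, t), i) \<in> Y \<and> (i, j) \<in> r \<and> i \<noteq> j))"
    and one: "\<And>s j. prod_encode (prod_encode (1, s), j) \<in> Y \<longleftrightarrow> j \<in> Field r \<and>
      p s = 1 \<and> (\<forall>i. prod_encode (prod_encode (0, s), i) \<in> Y \<longrightarrow> \<not> ((i, j) \<in> r \<and> i \<noteq> j))"
  shows "prod_encode (prod_encode (1, list_encode s), 0) \<in> Y \<longleftrightarrow> s = map x [0..<length s]"
proof -
  have wo: "Well_order r" and field: "Field r = {m. pair_node p m}"
    using Well_order_kb[OF tree path] r by simp_all
  have wf: "wf (r - Id)"
    using wo by (simp add: well_order_on_def)
  have seg: "p (list_encode (map x [0..<n])) = 1" for n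
    using path by (auto simp: paths_def)
  \<comment> \<open>To enter an initial segment at stage \<open>j\<close>, the next longer one must
    have been entered earlier, so \<open>n\<close> has to vary in the induction.\<close>
  have on_path: "prod_encode (prod_encode (0, list_encode (map x [0..<n])), j) \<notin> Y" for n j
    using wf
  proof (induction j arbitrary: n rule: wf_induct_rule)
    case (less j)
    have "child (list_encode (map x [0..<n])) (list_encode (map x [0..<Suc n]))"
      by (auto simp: child_def nth_default_def nth_append)
    then show ?case
      using zero seg less by (metis DiffI pair_in_Id_conv)
  qed
  have off_path: "prod_encode (prod_encode (0, list_encode s),
      Suc (prod_encode (n, prod_encode (list_encode s, list_encode (map x [0..<length s]))))) \<in> Y"
    if "p (list_encode s) = 1" "n < length s" "s ! n \<noteq> x n" for n s
  proof -
    \<comment> \<open>The disagreement \<open>n\<close> stays fixed for all extensions of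
      \<open>s\<close>, so the node of a child extends the node of \<open>s\<close>.\<close>
    define m where "m s = Suc (prod_encode (n, prod_encode (list_encode s, list_encode (map x [0..<length s]))))" for s
    have "prod_encode (prod_encode (0, list_encode s), m s) \<in> Y"
      using wf that
    proof (induction "m s" arbitrary: s rule: wf_induct_rule)
      case less
      have node: "m s \<in> Field r"
        using less.prems seg by (auto simp: field m_def pair_node_Suc)
      have "\<exists>i. prod_encode (prod_encode (0, t), i) \<in> Y \<and> (i, m s) \<in> r \<and> i \<noteq> m s"
        if t: "child (list_encode s) t" "p t = 1" for t
      proof -
        define u where "u = list_decode t"
        have u: "t = list_encode u" "length u = Suc (length s)" "\<And>i. i < length s \<Longrightarrow> u ! i = s ! i"
          using t(1) by (auto simp: u_def child_def nth_default_def)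
        have u': "n < length u" "u ! n \<noteq> x n"
          using u less.prems by auto
        have node': "pair_node p (m u)"
          using u(1) t(2) u' seg by (auto simp: m_def pair_node_Suc simp del: upt_Suc)
        have agree: "entry (m u) k = entry (m s) k" if "k < Suc (length s)" for k
          using that u by (cases k) (auto simp: m_def entry_Suc nth_default_def nth_append)
        have last: "entry (m u) (Suc (length s)) \<noteq> 0" "entry (m s) (Suc (length s)) = 0"
          using u by (auto simp: m_def entry_Suc)
        \<comment> \<open>A proper extension is smaller. The announcement occupies entry 0, so the
          node of \<open>s\<close> ends at \<open>Suc (length s)\<close>.\<close>
        have "kb_less (m u) (m s)"
          unfolding kb_less_def
          by (rule exI[of _ "Suc (length s)"]) (use entry_bound[OF last(1)] in \<open>simp add: agree last\<close>)
        moreover have "m u \<noteq> m s"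
          using last by metis
        ultimately have "(m u, m s) \<in> r" "m u \<noteq> m s"
          using node[unfolded field] node' by (simp_all add: r kb_le_def)
        moreover from this have "prod_encode (prod_encode (0, list_encode u), m u) \<in> Y"
          using less.hyps[of u] t(2) u u' by auto
        ultimately show ?thesis
          using u(1) by blast
      qed
      then show ?case
        using zero node by blast
    qed
    then show ?thesis by (simp add: m_def)
  qed
  have top: "0 \<in> Field r"
    by (simp add: field pair_node_def)
  show ?thesis
  proof
    assume mem: "prod_encode (prod_encode (1, list_encode s), 0) \<in> Y"
    show "s = map x [0..<length s]"
    proof (rule ccontr)
      assume "s \<noteq> map x [0..<length s]"
      then obtain n where n: "n < length s" "s ! n \<noteq> x n"
        by (metis add.left_neutral diff_zero length_map length_upt nth_equalityI nth_map_upt)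
      have s: "p (list_encode s) = 1"
        using mem one by blast
      let ?m = "Suc (prod_encode (n, prod_encode (list_encode s, list_encode (map x [0..<length s]))))"
      have Y: "prod_encode (prod_encode (0, list_encode s), ?m) \<in> Y"
        by (rule off_path[OF s n])
      then have "pair_node p ?m"
        using zero field by blast
      \<comment> \<open>The root has already ended at entry 0, so it lies above every other
        node.\<close>
      moreover have "kb_less ?m 0"
        unfolding kb_less_def by (intro exI[of _ 0]) (simp add: entry_Suc entry_def)
      ultimately have "(?m, 0) \<in> r"
        by (simp add: r kb_le_def pair_node_def)
      then show False
        using mem Y one by blast
    qed
  next
    assume "s = map x [0..<length s]"
    then show "prod_encode (prod_encode (1, list_encode s), 0) \<in> Y"
      using one top seg on_path by metis
  qed
qed

lemma computable_search:
  assumes P: "pr_pred (\<lambda>p z. P p (pfst z) (psnd z))" and F: "pr (\<lambda>p z. F p (pfst z) (psnd z))"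
  shows "\<exists>K. computable K \<and>
    (\<forall>p. (\<forall>x. \<exists>n. P p x n) \<longrightarrow> K p = Some (\<lambda>x. F p x (LEAST n. P p x n)))"
proof -
  \<comment> \<open>\<open>PMu\<close> searches for 0, so the indicator is inverted.\<close>
  have "pr (\<lambda>p z. 1 - (if P p (pfst z) (psnd z) then 1 else 0))"
    by (intro pr_intros P)
  then obtain c where c: "\<And>p x. run c p x = Some (1 - (if P p (pfst x) (psnd x) then 1 else 0))"
    by (auto simp: pr_def)
  obtain d where d: "\<And>p x. run d p x = Some (F p (pfst x) (psnd x))"
    using F by (auto simp: pr_def)
  obtain e where e: "decode_prog e = PComp d (PPair (PPair PFst PSnd) (PMu c))"
    using surj_decode_prog by blast
  have "phi e p = Some (\<lambda>x. F p x (LEAST n. P p x n))" if "\<forall>x. \<exists>n. P p x n" for p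
  proof -
    have "run c p (prod_encode (x, n)) = Some 0 \<longleftrightarrow> P p x n" for x n
      by (simp add: c)
    then have "run (decode_prog e) p x = Some (F p x (LEAST n. P p x n))" for x
      using that by (simp add: e d c)
    then show ?thesis
      by (simp add: phi_def)
  qed
  moreover have "computable (phi e)"
    unfolding computable_def by (intro exI[of _ e]) simp
  ultimately show ?thesis by blast
qed

theorem UC_baire_le_ATR: "UC_baire \<le>\<^sub>s\<^sub>W ATR"
proof -
  obtain e where e: "\<And>W. phi e W = Some (stage_fun W)"
  proof -
    obtain c where c: "\<And>p x. run c p x = Some (stage_fun p x)"
      using pr_stage_fun by (auto simp: pr_def)
    obtain e where "decode_prog e = c"
      using surj_decode_prog by blast
    then show thesis
      using that[of e] by (simp add: phi_def c)
  qed
  \<comment> \<open>Even positions carry the tree, positions 1 modulo 4 the Kleene-Brouwer order, 3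
    modulo 8 the constant \<open>k = 1\<close>, and 7 modulo 8 the program number
    \<open>e\<close>.\<close>
  define h where "h p w = (if even w then p (w div 2)
      else if even (w div 2) then
        (if kb_le p (pfst (w div 2 div 2)) (psnd (w div 2 div 2)) then 1 else 0)
      else if even (w div 2 div 2) then 1 else e)" for p w
  have "pr h"
  proof -
    have "pr (\<lambda>p w. h p w)"
      unfolding h_def by (intro pr_intros)
    then show ?thesis by simp
  qed
  then have H: "computable (\<lambda>p. Some (h p))"
    by (rule pr_computable)
  \<comment> \<open>Tag 1 in column 0, the stage of the root, certifies a segment of
    \<open>x\<close>; length \<open>Suc n\<close> makes entry \<open>n\<close> available.\<close>
  define P where "P q n s \<longleftrightarrow> q (prod_encode (prod_encode (1, s), 0)) = 1 \<and> length (list_decode s) = Suc n"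
    for q :: baire and n s
  have "pr_pred (\<lambda>p z. P p (pfst z) (psnd z))"
    unfolding P_def by (intro pr_intros)
  moreover have "pr (\<lambda>p z. nth_default (list_decode (psnd z)) (pfst z))"
    by (intro pr_intros)
  ultimately obtain K where K: "computable K"
    "\<And>q. (\<And>n. \<exists>s. P q n s) \<Longrightarrow> K q = Some (\<lambda>n. nth_default (list_decode (LEAST s. P q n s)) n)"
    using computable_search[of P "\<lambda>p n s. nth_default (list_decode s) n"] by blast
  have "realizes (K \<circ>\<^sub>m G \<circ>\<^sub>m (\<lambda>p. Some (h p))) UC_baire" if G: "realizes G ATR" for G
    unfolding realizes_def
  proof (intro allI impI, elim conjE)
    fix p T assume T: "inrep UC_baire p = Some T" and "sol UC_baire T \<noteq> {}"
    then obtain x where x: "sol UC_baire T = {x}" "paths T = {x}"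
      by (auto simp: UC_baire_def)
    have range: "range p \<subseteq> {0, 1}" and tree: "is_tree {s. p (list_encode s) = 1}"
      and T_eq: "T = {s. p (list_encode s) = 1}"
      using T by (auto simp: UC_baire_def tree_rep_def split: if_splits)
    have path: "paths {s. p (list_encode s) = 1} = {x}"
      using x(2) T_eq by simp
    define r where "r = {(m, m'). kb_le p m m'}"
    define Z where "Z = {m. p m = 1}"
    have wo: "Well_order r"
      using Well_order_kb(1)[OF tree path] by (simp add: r_def)
    have "set_rep (\<lambda>n. h p (2 * n)) = Some Z"
      using range by (auto simp: set_rep_def h_def Z_def)
    moreover have "{(m, m'). h p (2 * (2 * prod_encode (m, m')) + 1) = 1} = r"
      by (auto simp: h_def r_def)
    then have "wo_rep (\<lambda>n. h p (2 * (2 * n) + 1)) = Some r"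
      using wo by (simp add: wo_rep_def)
    moreover have "h p (2 * (2 * (2 * 0) + 1) + 1) = 1" "h p (2 * (2 * (2 * 0 + 1) + 1) + 1) = e"
      by (simp_all add: h_def)
    ultimately have name: "inrep ATR (h p) = Some (Z, r, 1, e)"
      unfolding ATR_def problem.simps prod_rep_eq_Some_iff nat_rep_def by simp
    have sol: "sol ATR (Z, r, 1, e) = {Y. \<forall>y j. prod_encode (y, j) \<in> Y \<longleftrightarrow>
        j \<in> Field r \<and> (\<forall>c. \<exists>i. stage_cond (chi (below r Y j \<oplus>\<^sub>j Z)) y c i)}"
      by (simp add: ATR_def theta_Suc_0[OF e])
    have "wf (r - Id)"
      using wo by (simp add: well_order_on_def)
    from transfinite_columns[OF this, of "\<lambda>B. {y. \<forall>c. \<exists>i. stage_cond (chi (B \<oplus>\<^sub>j Z)) y c i}"]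
    have "sol ATR (Z, r, 1, e) \<noteq> {}"
      unfolding sol by simp
    then obtain q Y where q: "G (h p) = Some q" "outrep ATR q = Some Y" "Y \<in> sol ATR (Z, r, 1, e)"
      using G[unfolded realizes_def, rule_format, of "h p" "(Z, r, 1, e)"] name by blast
    have Y: "Y = {m. q m = 1}"
      using q(2) by (auto simp: ATR_def set_rep_def split: if_splits)
    have detect: "prod_encode (prod_encode (1, list_encode s), 0) \<in> Y \<longleftrightarrow> s = map x [0..<length s]" for s
    proof (rule columns_detect_path[OF tree path r_def])
      have mem: "prod_encode (y, j) \<in> Y \<longleftrightarrow>
        j \<in> Field r \<and> (\<forall>c. \<exists>i. stage_cond (chi (below r Y j \<oplus>\<^sub>j Z)) y c i)" for y j
        using q(3) unfolding sol by blast
      fix s j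
      show "prod_encode (prod_encode (0, s), j) \<in> Y \<longleftrightarrow> j \<in> Field r \<and>
        (\<forall>t. child s t \<and> p t = 1 \<longrightarrow> (\<exists>i. prod_encode (prod_encode (0, t), i) \<in> Y \<and> (i, j) \<in> r \<and> i \<noteq> j))"
        using mem[of "prod_encode (0, s)" j] stage_op_iff(1)[of r Y j Z s] by (simp add: Z_def)
      show "prod_encode (prod_encode (1, s), j) \<in> Y \<longleftrightarrow> j \<in> Field r \<and>
        p s = 1 \<and> (\<forall>i. prod_encode (prod_encode (0, s), i) \<in> Y \<longrightarrow> \<not> ((i, j) \<in> r \<and> i \<noteq> j))"
        using mem[of "prod_encode (1, s)" j] stage_op_iff(2)[of r Y j Z s] by (simp add: Z_def)
    qed
    have P: "P q n s \<longleftrightarrow> list_decode s = map x [0..<Suc n]" for n s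
    proof -
      have "P q n s \<longleftrightarrow> list_decode s = map x [0..<length (list_decode s)] \<and> length (list_decode s) = Suc n"
        using detect[of "list_decode s"] by (simp add: P_def Y)
      then show ?thesis
        by (metis length_map length_upt diff_zero)
    qed
    have ex: "\<exists>s. P q n s" for n
      unfolding P by (rule exI[of _ "list_encode (map x [0..<Suc n])"]) simp
    have "nth_default (list_decode (LEAST s. P q n s)) n = x n" for n
    proof -
      have "P q n (LEAST s. P q n s)"
        using ex by (rule LeastI_ex)
      then show ?thesis
        unfolding P by (simp add: nth_default_def nth_append del: upt_Suc)
    qed
    then have "K q = Some x"
      using K(2)[of q] ex by simp
    then show "\<exists>q y. (K \<circ>\<^sub>m G \<circ>\<^sub>m (\<lambda>p. Some (h p))) p = Some q \<and> outrep UC_baire q = Some y \<and> y \<in> sol UC_baire T"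
      using q(1) x(1) by (intro exI[of _ x]) (simp add: map_comp_def UC_baire_def baire_rep_def)
  qed
  then show ?thesis
    unfolding sW_le_def using H K(1) by blast
qed

theorem theorem3p13:
  shows "ATR \<equiv>\<^sub>s\<^sub>W UC_baire"
  unfolding sW_equiv_def using ATR_le_UC_baire UC_baire_le_ATR by blast

end
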